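(* Let $(X,d)$ be a proper metric space equipped with a Radon measure $\mu$ whose support is $X$, and let $p\in[1,\infty)$. Let $E$ be a complex Banach space, and let $a\in\mathfrak{B}(L^p(X;E))$ satisfy $a\in\mathrm{Commut}(L,\varepsilon)$ for some $L,\varepsilon>0$. Let $(e_j)_{j\in J}$ be an equicontinuous family of positive contractions in $C_b(X)$ with $2/L$-disjoint supports, and define $e:=\sum_{j\in J}e_j$. Then $$\Big\|eae-\sum_{j\in J}e_jae_j\Big\|\le\varepsilon .$$
   Context: A metric space is proper if every bounded subset is pre-compact. A Radon measure is a regular Borel measure finite on compact sets; its support is $X$ if every $x\in X$ has a neighbourhood of positive measure. $L^p(X;E)=L^p(X,\mu;E)$ is the Bochner $L^p$-space of $E$-valued functions. $\mathfrak{B}(\cdot)$ denotes bounded linear operators. $C_b(X)$ is the algebra of bounded continuous complex functions on $X$, $C_b(X)_1$ its closed unit ball; $f\in C_b(X)$ acts on $L^p(X;E)$ by pointwise multiplication and is identified with that operator; $[a,f]=af-fa$. For $L,\varepsilon>0$, $$\mathrm{Commut}(L,\varepsilon)=\{a\in\mathfrak{B}(L^p(X;E)):\|[a,f]\|<\varepsilon\text{ for every }L\text{-Lipschitz }f\in C_b(X)_1\}.$$ A family $(Y_j)_{j\in J}$ of subsets of $X$ is $R$-disjoint if $d(Y_j,Y_{j'})>R$ for all $j\neq j'$. The sum defining $e$ is taken pointwise (it gives a function in $C_b(X)$), and the sum $\sum_{j\in J}e_jae_j$ converges in the strong operator topology. *)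

theory Defs
  imports "HOL-Analysis.Analysis" "HOL-Library.Nonpos_Ints"
begin

class complex_banach = banach +
  fixes scaleC :: "complex \<Rightarrow> 'a \<Rightarrow> 'a" (infixr \<open>*\<^sub>C\<close> 75)
  assumes scaleC_add_right: "c *\<^sub>C (x + y) = c *\<^sub>C x + c *\<^sub>C y"
    and scaleC_add_left: "(b + c) *\<^sub>C x = b *\<^sub>C x + c *\<^sub>C x"
    and scaleC_scaleC: "b *\<^sub>C c *\<^sub>C x = (b * c) *\<^sub>C x"
    and scaleC_one: "1 *\<^sub>C x = x"
    and scaleC_of_real: "complex_of_real r *\<^sub>C x = r *\<^sub>R x"
    and norm_scaleC: "norm (c *\<^sub>C x) = cmod c * norm x"

definition proper_space :: "'x::metric_space itself \<Rightarrow> bool" where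
  "proper_space _ \<longleftrightarrow> (\<forall>S::'x set. bounded S \<longrightarrow> compact (closure S))"

definition radon_measure :: "'x::topological_space measure \<Rightarrow> bool" where
  "radon_measure M \<longleftrightarrow>
     sets M = sets borel \<and>
     (\<forall>K. compact K \<longrightarrow> emeasure M K < \<infinity>) \<and>
     (\<forall>A\<in>sets M. emeasure M A = (INF U\<in>{U. open U \<and> A \<subseteq> U}. emeasure M U)) \<and>
     (\<forall>A\<in>sets M. emeasure M A = (SUP K\<in>{K. compact K \<and> K \<subseteq> A}. emeasure M K))"

text \<open>
  Only some neighbourhood of each point is required to have positive measure. This follows
  from the usual condition that every neighbourhood does, so a theorem that assumes
  \<open>full_support M\<close> also holds under the usual condition.
\<close>

definition full_support :: "'x::topological_space measure \<Rightarrow> bool" where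
  "full_support M \<longleftrightarrow> (\<forall>x. \<exists>U. open U \<and> x \<in> U \<and> emeasure M U > 0)"

text \<open>
  The library's Bochner theory is restricted to second countable value spaces. Here the value
  space may be non-separable, so strong measurability is approximation by simple functions
  almost everywhere.
\<close>

definition strongly_measurable :: "'x measure \<Rightarrow> ('x \<Rightarrow> 'e::topological_space) \<Rightarrow> bool" where
  "strongly_measurable M f \<longleftrightarrow>
     (\<exists>s. (\<forall>n::nat. simple_function M (s n)) \<and> (AE x in M. (\<lambda>n. s n x) \<longlonglongrightarrow> f x))"

definition Lp_functions :: "'x measure \<Rightarrow> real \<Rightarrow> ('x \<Rightarrow> 'e::real_normed_vector) set" where
  "Lp_functions M p =
     {f. strongly_measurable M f \<and> (\<integral>\<^sup>+x. ennreal (norm (f x) powr p) \<partial>M) < \<infinity>}"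

definition Lp_seminorm :: "'x measure \<Rightarrow> real \<Rightarrow> ('x \<Rightarrow> 'e::real_normed_vector) \<Rightarrow> real" where
  "Lp_seminorm M p f = enn2real (\<integral>\<^sup>+x. ennreal (norm (f x) powr p) \<partial>M) powr (1 / p)"

definition ae_eq :: "'x measure \<Rightarrow> real \<Rightarrow> (('x \<Rightarrow> 'e::real_normed_vector) \<times> ('x \<Rightarrow> 'e)) set" where
  "ae_eq M p = {(f, g). f \<in> Lp_functions M p \<and> g \<in> Lp_functions M p \<and> (AE x in M. f x = g x)}"

definition Lp :: "'x measure \<Rightarrow> real \<Rightarrow> ('x \<Rightarrow> 'e::real_normed_vector) set set" where
  "Lp M p = Lp_functions M p // ae_eq M p"

definition Lp_norm :: "'x measure \<Rightarrow> real \<Rightarrow> ('x \<Rightarrow> 'e::real_normed_vector) set \<Rightarrow> real" where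
  "Lp_norm M p u = the_elem (Lp_seminorm M p ` u)"

text \<open>
  The operations on classes are unions over representatives, as in the library's
  treatment of quotients. For arguments in \<open>Lp M p\<close> and a bounded Borel multiplier
  \<open>\<phi>\<close>, all members of the union are the same class.
\<close>

definition Lp_sum ::
    "'x measure \<Rightarrow> real \<Rightarrow> 'j set \<Rightarrow> ('j \<Rightarrow> ('x \<Rightarrow> 'e::real_normed_vector) set) \<Rightarrow> ('x \<Rightarrow> 'e) set" where
  "Lp_sum M p F u = (\<Union>f\<in>Pi F u. ae_eq M p `` {\<lambda>x. \<Sum>j\<in>F. f j x})"

definition Lp_add ::
    "'x measure \<Rightarrow> real \<Rightarrow> ('x \<Rightarrow> 'e::real_normed_vector) set \<Rightarrow> ('x \<Rightarrow> 'e) set \<Rightarrow> ('x \<Rightarrow> 'e) set" where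
  "Lp_add M p u v = (\<Union>f\<in>u. \<Union>g\<in>v. ae_eq M p `` {\<lambda>x. f x + g x})"

definition Lp_diff ::
    "'x measure \<Rightarrow> real \<Rightarrow> ('x \<Rightarrow> 'e::real_normed_vector) set \<Rightarrow> ('x \<Rightarrow> 'e) set \<Rightarrow> ('x \<Rightarrow> 'e) set" where
  "Lp_diff M p u v = (\<Union>f\<in>u. \<Union>g\<in>v. ae_eq M p `` {\<lambda>x. f x - g x})"

definition Lp_mult ::
    "'x measure \<Rightarrow> real \<Rightarrow> ('x \<Rightarrow> complex) \<Rightarrow> ('x \<Rightarrow> 'e::complex_banach) set \<Rightarrow> ('x \<Rightarrow> 'e) set" where
  "Lp_mult M p \<phi> u = (\<Union>f\<in>u. ae_eq M p `` {\<lambda>x. \<phi> x *\<^sub>C f x})"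

definition Lp_bounded_operators ::
    "'x measure \<Rightarrow> real \<Rightarrow> (('x \<Rightarrow> 'e::complex_banach) set \<Rightarrow> ('x \<Rightarrow> 'e) set) set" where
  "Lp_bounded_operators M p =
     {T \<in> Lp M p \<rightarrow> Lp M p.
        (\<forall>u\<in>Lp M p. \<forall>v\<in>Lp M p. T (Lp_add M p u v) = Lp_add M p (T u) (T v)) \<and>
        (\<forall>c. \<forall>u\<in>Lp M p. T (Lp_mult M p (\<lambda>_. c) u) = Lp_mult M p (\<lambda>_. c) (T u)) \<and>
        (\<exists>C. \<forall>u\<in>Lp M p. Lp_norm M p (T u) \<le> C * Lp_norm M p u)}"

text \<open>The value is \<open>\<infinity>\<close> for unbounded operators.\<close>

definition Lp_opnorm ::
    "'x measure \<Rightarrow> real \<Rightarrow> (('x \<Rightarrow> 'e::real_normed_vector) set \<Rightarrow> ('x \<Rightarrow> 'e) set) \<Rightarrow> ennreal" where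
  "Lp_opnorm M p T = (SUP u\<in>{u \<in> Lp M p. Lp_norm M p u \<le> 1}. ennreal (Lp_norm M p (T u)))"

definition Lp_commutator ::
    "'x measure \<Rightarrow> real \<Rightarrow> (('x \<Rightarrow> 'e::complex_banach) set \<Rightarrow> ('x \<Rightarrow> 'e) set) \<Rightarrow> ('x \<Rightarrow> complex)
      \<Rightarrow> ('x \<Rightarrow> 'e) set \<Rightarrow> ('x \<Rightarrow> 'e) set" where
  "Lp_commutator M p a \<phi> = (\<lambda>u. Lp_diff M p (a (Lp_mult M p \<phi> u)) (Lp_mult M p \<phi> (a u)))"

definition Commut ::
    "'x::metric_space measure \<Rightarrow> real \<Rightarrow> real \<Rightarrow> real
      \<Rightarrow> (('x \<Rightarrow> 'e::complex_banach) set \<Rightarrow> ('x \<Rightarrow> 'e) set) set" where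
  "Commut M p L \<epsilon> =
     {a \<in> Lp_bounded_operators M p.
        \<forall>f :: 'x \<Rightarrow>\<^sub>C complex. norm f \<le> 1 \<and> L-lipschitz_on UNIV (apply_bcontfun f)
          \<longrightarrow> Lp_opnorm M p (Lp_commutator M p a (apply_bcontfun f)) < ennreal \<epsilon>}"

text \<open>Unordered convergence of \<open>\<Sum>j\<in>J. T j\<close> to \<open>S\<close> in the strong operator topology.\<close>

definition has_strong_sum ::
    "'x measure \<Rightarrow> real \<Rightarrow> ('j \<Rightarrow> ('x \<Rightarrow> 'e::real_normed_vector) set \<Rightarrow> ('x \<Rightarrow> 'e) set)
      \<Rightarrow> 'j set \<Rightarrow> (('x \<Rightarrow> 'e) set \<Rightarrow> ('x \<Rightarrow> 'e) set) \<Rightarrow> bool" where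
  "has_strong_sum M p T J S \<longleftrightarrow>
     (\<forall>u\<in>Lp M p.
        ((\<lambda>F. Lp_norm M p (Lp_diff M p (Lp_sum M p F (\<lambda>j. T j u)) (S u))) \<longlongrightarrow> 0)
          (finite_subsets_at_top J))"

definition closed_support :: "('x::topological_space \<Rightarrow> 'b::zero) \<Rightarrow> 'x set" where
  "closed_support f = closure {x. f x \<noteq> 0}"

text \<open>The distance to the empty set is infinite, whereas \<^const>\<open>setdist\<close> gives 0 there.\<close>

definition R_disjoint :: "real \<Rightarrow> ('j \<Rightarrow> 'x::metric_space set) \<Rightarrow> 'j set \<Rightarrow> bool" where
  "R_disjoint R Y J \<longleftrightarrow>
     (\<forall>j\<in>J. \<forall>k\<in>J. j \<noteq> k \<longrightarrow> Y j = {} \<or> Y k = {} \<or> setdist (Y j) (Y k) > R)"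

definition equicontinuous_family ::
    "('j \<Rightarrow> 'x::metric_space \<Rightarrow> 'b::metric_space) \<Rightarrow> 'j set \<Rightarrow> bool" where
  "equicontinuous_family f J \<longleftrightarrow>
     (\<forall>x. \<forall>\<epsilon>>0. \<exists>\<delta>>0. \<forall>j\<in>J. \<forall>y. dist y x < \<delta> \<longrightarrow> dist (f j y) (f j x) < \<epsilon>)"

definition positive_contraction :: "('x::topological_space \<Rightarrow>\<^sub>C complex) \<Rightarrow> bool" where
  "positive_contraction f \<longleftrightarrow> (\<forall>x. apply_bcontfun f x \<in> \<real>\<^sub>\<ge>\<^sub>0) \<and> norm f \<le> 1"

end

theory Submission
  imports Defs
begin

text \<open>
  For a set \<open>B\<close> of indices there is an \<open>L\<close>-Lipschitz function \<open>\<psi>\<close> with values in \<open>[-1, 1]\<close> that is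
  \<open>1\<close> on the supports of the \<open>e\<^sub>j\<close> with \<open>j \<in> B\<close> and \<open>-1\<close> on the other supports: truncate the distance
  functions at radius \<open>1/L\<close>. Fix a finite set \<open>F\<close> and average over \<open>B \<subseteq> F\<close>. By orthogonality
  of signs, at a point of the support of \<open>e\<^sub>j\<close> with \<open>j \<in> F\<close>, the function
  \<open>(eae - \<Sum>e\<^sub>kae\<^sub>k) f\<close> is the average of \<open>\<plusminus>e\<^sub>j [a, \<psi>] e f\<close>. Convexity of \<open>t \<mapsto> t\<^sup>p\<close> bounds the
  integral of its \<open>p\<close>-th power over these supports by \<open>\<epsilon>\<^sup>p\<close>, uniformly in \<open>F\<close>. The index set \<open>F\<close> can
  then be enlarged, because properness leaves only countably many nonzero \<open>e\<^sub>j\<close>.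
\<close>

subsection \<open>Convexity and countable unions\<close>

text \<open>The obstacle is that a commutator estimate for each index alone bounds every
  \<open>e\<^sub>j a (e - e\<^sub>j)\<close> by \<epsilon>, and such bounds do not combine to
  \<epsilon> over many blocks. One shared family of sign functions treats all blocks at once: each
  point lies in at most one block, so the sign attached to that block does not change the norm
  there, and the same average of p-th powers dominates on every block. The constant 2/L is exactly
  the room in which an L-Lipschitz function can pass from 1 to -1. A finite F keeps the average a
  finite sum; indices outside F carry the constant sign -1, which is still orthogonal to the sign of
  each index in F.

  The strong sum is not produced as a limit but written down: representatives of all
  \<open>e\<^sub>j a e\<^sub>j f\<close> are chosen and glued along the disjoint supports. Two
  things have to be watched. Values may be non-separable, so a representative is an a.e. limit of
  simple functions, and its norm is handled as a measurable function for the completion of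
  \<open>M\<close>. Linearity of \<open>a\<close> on representatives holds only a.e., and the
  exceptional sets of different blocks can be united only over countably many nonempty
  blocks.\<close>

interpretation scaleC: bounded_bilinear "scaleC :: complex \<Rightarrow> 'e::complex_banach \<Rightarrow> 'e"
proof
  fix a b :: complex and x y :: 'e and r :: real
  show "(r *\<^sub>R a) *\<^sub>C x = r *\<^sub>R (a *\<^sub>C x)"
    by (simp add: scaleR_conv_of_real scaleC_scaleC[symmetric] scaleC_of_real)
  show "a *\<^sub>C (r *\<^sub>R x) = r *\<^sub>R (a *\<^sub>C x)"
    by (simp add: scaleC_of_real[symmetric] scaleC_scaleC mult.commute)
  show "\<exists>K. \<forall>a (x :: 'e). norm (a *\<^sub>C x) \<le> norm a * norm x * K"
    by (intro exI[of _ 1]) (simp add: norm_scaleC)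
qed (fact scaleC_add_left scaleC_add_right)+

text \<open>Bound the sum by twice the larger term. The crude constant suffices because only
  finiteness of an integral is deduced from it.\<close>

lemma powr_add_le:
  fixes x y p :: real
  assumes "0 \<le> x" "0 \<le> y" "0 \<le> p"
  shows "(x + y) powr p \<le> 2 powr p * (x powr p + y powr p)"
proof -
  have "(x + y) powr p \<le> (2 * max x y) powr p"
    using assms by (intro powr_mono2) auto
  also have "\<dots> = 2 powr p * max x y powr p"
    using assms by (simp add: powr_mult)
  also have "max x y powr p \<le> x powr p + y powr p"
    by (auto simp: max_def)
  finally show ?thesis by simp
qed

text \<open>Norms may vanish, so the endpoint 0 has to be added to convexity on the open half-line.
  There the inequality reduces to \<open>t powr p \<le> t\<close> for 0 < t < 1.\<close>

lemma convex_on_powr: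
  fixes p :: real
  assumes "1 \<le> p"
  shows "convex_on {0..} (\<lambda>x. x powr p)"
proof (rule convex_onI)
  have *: "(t * y) powr p \<le> t * y powr p" if "0 < t" "t < 1" "0 \<le> y" for t y :: real
    using that assms powr_mono'[of 1 p t] by (auto simp: powr_mult intro!: mult_right_mono)
  fix t x y :: real
  assume t: "0 < t" "t < 1" and xy: "x \<in> {0..}" "y \<in> {0..}"
  consider "x = 0" | "y = 0" | "0 < x" "0 < y" using xy by fastforce
  then show "((1 - t) *\<^sub>R x + t *\<^sub>R y) powr p \<le> (1 - t) * x powr p + t * y powr p"
  proof cases
    case 3
    then show ?thesis
      using convex_onD[OF powr_convex[OF assms], of t x y] t by simp
  qed (use * [of t y] * [of "1 - t" x] t xy in auto)
qed simp

text \<open>The triangle inequality followed by Jensen for equal weights; this is where p \<ge> 1 is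
  decisive for the final estimate.\<close>

lemma powr_norm_average_le:
  fixes v :: "'a \<Rightarrow> 'e::real_normed_vector"
  assumes "1 \<le> p" "finite I" "I \<noteq> {}"
  shows "norm ((1 / real (card I)) *\<^sub>R (\<Sum>i\<in>I. v i)) powr p
    \<le> (\<Sum>i\<in>I. norm (v i) powr p) / real (card I)"
proof -
  have card: "card I > 0" using assms by (simp add: card_gt_0_iff)
  have "norm ((1 / real (card I)) *\<^sub>R (\<Sum>i\<in>I. v i)) \<le> (\<Sum>i\<in>I. (1 / real (card I)) *\<^sub>R norm (v i))"
    using norm_sum[of v I] by (simp add: sum_divide_distrib[symmetric] divide_right_mono)
  then have "norm ((1 / real (card I)) *\<^sub>R (\<Sum>i\<in>I. v i)) powr p
      \<le> (\<Sum>i\<in>I. (1 / real (card I)) *\<^sub>R norm (v i)) powr p"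
    using assms by (intro powr_mono2) auto
  also have "\<dots> \<le> (\<Sum>i\<in>I. (1 / real (card I)) * norm (v i) powr p)"
    using card assms by (intro convex_on_sum[OF _ _ convex_on_powr]) auto
  finally show ?thesis by (simp add: sum_divide_distrib)
qed

text \<open>Continuity from below of the measure with density \<open>h\<close>, along the finite
  unions of an enumeration of the nonempty blocks. The index set itself may be uncountable.\<close>

lemma nn_integral_UN_le:
  assumes h: "h \<in> borel_measurable M"
    and J: "countable {j\<in>J. A j \<noteq> {}}" "\<And>j. j \<in> J \<Longrightarrow> A j \<in> sets M"
    and bound: "\<And>F. finite F \<Longrightarrow> F \<subseteq> J \<Longrightarrow> (\<integral>\<^sup>+x. h x * indicator (\<Union>j\<in>F. A j) x \<partial>M) \<le> c"
  shows "(\<integral>\<^sup>+x. h x * indicator (\<Union>j\<in>J. A j) x \<partial>M) \<le> c"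
proof (cases "{j\<in>J. A j \<noteq> {}} = {}")
  case True
  then have "(\<Union>j\<in>J. A j) = {}" by auto
  then show ?thesis by simp
next
  case False
  define I where "I = {j\<in>J. A j \<noteq> {}}"
  \<comment> \<open>\<open>from_nat_into\<close> stays inside a nonempty \<open>I\<close> even when
    \<open>I\<close> is finite and the enumeration repeats; hence the separate case of an empty
    \<open>I\<close>.\<close>
  define B where "B n = (\<Union>i\<le>n. A (from_nat_into I i))" for n :: nat
  have I: "from_nat_into I i \<in> J" for i
    using from_nat_into[of I i] False by (auto simp: I_def)
  have B: "range B \<subseteq> sets M" using J(2) I by (auto simp: B_def)
  have UN: "(\<Union>j\<in>J. A j) = (\<Union>n. B n)"
  proof -
    have "(\<Union>j\<in>J. A j) = (\<Union>j\<in>range (from_nat_into I). A j)"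
      using False J(1) by (subst range_from_nat_into) (auto simp: I_def)
    then show ?thesis by (auto simp: B_def)
  qed
  have em: "emeasure (density M h) X = (\<integral>\<^sup>+x. h x * indicator X x \<partial>M)" if "X \<in> sets M" for X
    using h that by (rule emeasure_density)
  have "(\<integral>\<^sup>+x. h x * indicator (\<Union>j\<in>J. A j) x \<partial>M) = emeasure (density M h) (\<Union>n. B n)"
    using B by (subst em) (auto simp: UN)
  also have "\<dots> = (SUP n. emeasure (density M h) (B n))"
    using B by (intro SUP_emeasure_incseq[symmetric]) (fastforce simp: B_def incseq_Suc_iff)+
  also have "\<dots> \<le> c"
  proof (rule SUP_least)
    fix n
    have eq: "B n = (\<Union>j\<in>from_nat_into I ` {..n}. A j)" by (simp add: B_def)
    have "B n \<in> sets M" using B by auto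
    then show "emeasure (density M h) (B n) \<le> c"
      unfolding em[OF \<open>B n \<in> sets M\<close>] unfolding eq using I by (intro bound) auto
  qed
  finally show ?thesis .
qed

text \<open>If every tail had integral at least \<delta>, every finite part would be at most the
  total minus \<delta>, and by the preceding lemma so would the total, which is finite.\<close>

lemma nn_integral_UN_tail:
  assumes h: "h \<in> borel_measurable M" "(\<integral>\<^sup>+x. h x \<partial>M) < \<infinity>"
    and J: "countable {j\<in>J. A j \<noteq> {}}" "\<And>j. j \<in> J \<Longrightarrow> A j \<in> sets M"
    and disj: "disjoint_family_on A J"
    and \<delta>: "0 < \<delta>"
  shows "\<exists>F. finite F \<and> F \<subseteq> J \<and> (\<integral>\<^sup>+x. h x * indicator (\<Union>j\<in>J - F. A j) x \<partial>M) < \<delta>"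
proof -
  define T where "T F = (\<integral>\<^sup>+x. h x * indicator (\<Union>j\<in>F. A j) x \<partial>M)" for F
  have meas: "(\<Union>j\<in>F. A j) \<in> sets M" if "F \<subseteq> J" for F
  proof -
    have "(\<Union>j\<in>F. A j) = (\<Union>j\<in>F \<inter> {j\<in>J. A j \<noteq> {}}. A j)" using that by auto
    also have "\<dots> \<in> sets M" using that J by (intro sets.countable_UN') auto
    finally show ?thesis .
  qed
  have fin: "T F < \<infinity>" for F
    by (rule le_less_trans[OF _ h(2)])
      (auto simp: T_def intro!: nn_integral_mono split: split_indicator)
  have split: "T J = T F + T (J - F)" if "F \<subseteq> J" for F
  proof -
    have "T J = (\<integral>\<^sup>+x. h x * indicator (\<Union>j\<in>F. A j) x + h x * indicator (\<Union>j\<in>J - F. A j) x \<partial>M)"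
      unfolding T_def
    proof (rule nn_integral_cong)
      fix x
      have "(\<Union>j\<in>F. A j) \<inter> (\<Union>j\<in>J - F. A j) = {}"
        using that disj by (fastforce simp: disjoint_family_on_def)
      then have "indicator (\<Union>j\<in>J. A j) x
          = (indicator (\<Union>j\<in>F. A j) x + indicator (\<Union>j\<in>J - F. A j) x :: ennreal)"
        using that by (auto split: split_indicator)
      then show "h x * indicator (\<Union>j\<in>J. A j) x
          = h x * indicator (\<Union>j\<in>F. A j) x + h x * indicator (\<Union>j\<in>J - F. A j) x"
        by (simp add: distrib_left)
    qed
    then show ?thesis
      using h(1) meas[of F] meas[of "J - F"] that unfolding T_def
      by (subst (asm) nn_integral_add) auto
  qed
  show ?thesis
  proof (rule ccontr)
    assume none: "\<not> ?thesis"
    have big: "\<delta> \<le> T (J - F)" if "finite F" "F \<subseteq> J" for F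
      using none that unfolding T_def by (meson not_less)
    have TJ: "\<delta> \<le> T J" using big[of "{}"] by simp
    \<comment> \<open>Subtracting \<delta> undoes adding it in \<open>ennreal\<close> only for
      finite \<delta>.\<close>
    then have \<delta>': "\<delta> \<noteq> top" using fin[of J] le_less_trans by fastforce
    define c where "c = T J - \<delta>"
    have le: "T F \<le> c" if "finite F" "F \<subseteq> J" for F
    proof -
      have "T F = T F + \<delta> - \<delta>" using \<delta>' by simp
      also have "\<dots> \<le> c"
        unfolding c_def split[OF that(2)] using big[OF that]
        by (intro ennreal_minus_mono add_left_mono) auto
      finally show ?thesis .
    qed
    have "T J \<le> c"
      unfolding T_def[of J] by (rule nn_integral_UN_le[OF h(1) J]) (assumption, rule le[unfolded T_def])
    then have "T J + \<delta> \<le> c + \<delta>" by (rule add_right_mono)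
    also have "\<dots> = T J + 0" using TJ by (simp add: c_def diff_add_cancel_ennreal)
    finally have "\<delta> \<le> 0"
      using fin[of J] by (subst (asm) ennreal_add_left_cancel_le) auto
    then show False using \<delta> by simp
  qed
qed

subsection \<open>Strong measurability\<close>

text \<open>Simple functions stay simple under any binary operation, so only passage to the limit
  has to be assumed of \<open>h\<close>, and sequences are enough for that.\<close>

lemma strongly_measurable_compose2:
  assumes f: "strongly_measurable M f" and g: "strongly_measurable M g"
    and h: "\<And>s t a b. s \<longlonglongrightarrow> a \<Longrightarrow> t \<longlonglongrightarrow> b \<Longrightarrow> (\<lambda>n::nat. h (s n) (t n)) \<longlonglongrightarrow> h a b"
  shows "strongly_measurable M (\<lambda>x. h (f x) (g x))"
proof -
  obtain s t where s: "\<And>n::nat. simple_function M (s n)" "AE x in M. (\<lambda>n. s n x) \<longlonglongrightarrow> f x"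
    and t: "\<And>n::nat. simple_function M (t n)" "AE x in M. (\<lambda>n. t n x) \<longlonglongrightarrow> g x"
    using f g by (auto simp: strongly_measurable_def)
  have "AE x in M. (\<lambda>n. h (s n x) (t n x)) \<longlonglongrightarrow> h (f x) (g x)"
    using s(2) t(2) by eventually_elim (rule h)
  then show ?thesis
    unfolding strongly_measurable_def
    using simple_function_compose2[OF s(1) t(1), of h] by (intro exI[of _ "\<lambda>n x. h (s n x) (t n x)"]) auto
qed

lemma strongly_measurable_add:
  fixes f :: "'a \<Rightarrow> 'b::real_normed_vector"
  assumes "strongly_measurable M f" "strongly_measurable M g"
  shows "strongly_measurable M (\<lambda>x. f x + g x)"
  using assms by (rule strongly_measurable_compose2[where h = "(+)"]) (rule tendsto_add)

lemma strongly_measurable_scaleC: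
  assumes "strongly_measurable M \<phi>" "strongly_measurable M f"
  shows "strongly_measurable M (\<lambda>x. \<phi> x *\<^sub>C f x)"
  using assms by (rule strongly_measurable_compose2[where h = scaleC]) (rule scaleC.tendsto)

lemma strongly_measurable_const: "strongly_measurable M (\<lambda>_. c)"
  unfolding strongly_measurable_def by (intro exI[of _ "\<lambda>_ _. c"]) auto

text \<open>The entry point for the multipliers: their values are complex numbers, a separable
  space, so Borel measurability gives approximation by simple functions.\<close>

lemma strongly_measurable_borel:
  fixes f :: "'a \<Rightarrow> 'b::{metric_space, second_countable_topology}"
  assumes "f \<in> borel_measurable M"
  shows "strongly_measurable M f"
proof -
  obtain s where "\<And>n. simple_function M (s n)" "\<And>x. x \<in> space M \<Longrightarrow> (\<lambda>n. s n x) \<longlonglongrightarrow> f x"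
    using borel_measurable_implies_sequence_metric[OF assms] by metis
  then show ?thesis
    unfolding strongly_measurable_def by (intro exI[of _ s]) auto
qed

lemma strongly_measurable_cong_AE:
  assumes "strongly_measurable M f" and "AE x in M. f x = g x"
  shows "strongly_measurable M g"
proof -
  obtain s where s: "\<And>n::nat. simple_function M (s n)" "AE x in M. (\<lambda>n. s n x) \<longlonglongrightarrow> f x"
    using assms by (auto simp: strongly_measurable_def)
  have "AE x in M. (\<lambda>n. s n x) \<longlonglongrightarrow> g x"
    using s(2) assms(2) by eventually_elim simp
  with s(1) show ?thesis by (auto simp: strongly_measurable_def)
qed

text \<open>Preimages under the two functions differ by a subset of a null set, and such subsets are
  measurable in the completion.\<close>

lemma borel_measurable_cong_AE_completion:
  fixes f :: "'a \<Rightarrow> real"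
  assumes "h \<in> borel_measurable M" and ae: "AE x in M. f x = h x"
  shows "f \<in> borel_measurable (completion M)"
proof (rule measurableI)
  fix B :: "real set" assume B: "B \<in> sets borel"
  have "h \<in> borel_measurable (completion M)"
    using assms(1) by (rule measurable_completion)
  then have "h -` B \<inter> space (completion M) \<in> sets (completion M)"
    using B by (rule measurable_sets)
  moreover have "AE x in completion M. x \<in> h -` B \<inter> space (completion M)
      \<longleftrightarrow> x \<in> f -` B \<inter> space (completion M)"
    using AE_completion[OF ae] by eventually_elim auto
  ultimately show "f -` B \<inter> space (completion M) \<in> sets (completion M)"
    using completion.in_sets_AE by blast
qed simp

text \<open>The norms of the simple approximants have a limit a.e. Taking \<open>lim\<close> also at
  points of divergence gives a version that is measurable for \<open>M\<close> itself, and the norm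
  of \<open>f\<close> agrees with it a.e.\<close>

lemma borel_measurable_norm_strongly_measurable:
  fixes f :: "'a \<Rightarrow> 'b::real_normed_vector"
  assumes "strongly_measurable M f"
  shows "(\<lambda>x. norm (f x)) \<in> borel_measurable (completion M)"
proof -
  obtain s where s: "\<And>n::nat. simple_function M (s n)" "AE x in M. (\<lambda>n. s n x) \<longlonglongrightarrow> f x"
    using assms by (auto simp: strongly_measurable_def)
  have "(\<lambda>x. norm (s n x)) \<in> borel_measurable M" for n
    using simple_function_compose[OF s(1)[of n], of norm]
    by (intro borel_measurable_simple_function) (simp add: comp_def)
  then have "(\<lambda>x. lim (\<lambda>n. norm (s n x))) \<in> borel_measurable M"
    by (rule borel_measurable_lim_metric)
  moreover have "AE x in M. norm (f x) = lim (\<lambda>n. norm (s n x))"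
    using s(2) by eventually_elim (metis limI tendsto_norm)
  ultimately show ?thesis
    by (rule borel_measurable_cong_AE_completion)
qed

text \<open>For disjoint blocks this is the sum over j of \<open>g j\<close> cut off to
  \<open>A j\<close>. Selecting the block replaces an infinite sum, so no question of convergence
  arises and the values need no addition.\<close>

definition glue :: "('j \<Rightarrow> 'x set) \<Rightarrow> 'j set \<Rightarrow> ('j \<Rightarrow> 'x \<Rightarrow> 'b::zero) \<Rightarrow> 'x \<Rightarrow> 'b" where
  "glue A J g x = (if \<exists>j\<in>J. x \<in> A j then g (THE j. j \<in> J \<and> x \<in> A j) x else 0)"

lemma glue_in:
  assumes "disjoint_family_on A J" "j \<in> J" "x \<in> A j"
  shows "glue A J g x = g j x"
proof -
  have "(THE j. j \<in> J \<and> x \<in> A j) = j"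
    using assms by (intro the_equality) (auto simp: disjoint_family_on_def)
  then show ?thesis using assms by (auto simp: glue_def)
qed

lemma glue_out: "(\<And>j. j \<in> J \<Longrightarrow> x \<notin> A j) \<Longrightarrow> glue A J g x = 0"
  by (auto simp: glue_def)

text \<open>The n-th approximant glues the n-th simple functions of only those nonempty blocks whose
  number is below n, which keeps its range finite. A point of block j sees the approximants of
  \<open>g j\<close> from stage \<open>num j + 1\<close> on, so the limit is unaffected.\<close>

lemma strongly_measurable_glue:
  fixes g :: "'j \<Rightarrow> 'x \<Rightarrow> 'b::{zero,topological_space}"
  assumes disj: "disjoint_family_on A J"
    and J: "countable {j\<in>J. A j \<noteq> {}}" "\<And>j. j \<in> J \<Longrightarrow> A j \<in> sets M"
    and g: "\<And>j. j \<in> J \<Longrightarrow> strongly_measurable M (g j)"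
  shows "strongly_measurable M (glue A J g)"
proof -
  define I where "I = {j\<in>J. A j \<noteq> {}}"
  have I: "countable I" "I \<subseteq> J" using J by (auto simp: I_def)
  define num where "num = to_nat_on I"
  have "\<forall>j\<in>J. \<exists>s. (\<forall>n::nat. simple_function M (s n)) \<and> (AE x in M. (\<lambda>n. s n x) \<longlonglongrightarrow> g j x)"
    using g unfolding strongly_measurable_def by blast
  from bchoice[OF this] obtain s where s: "\<And>j n. j \<in> J \<Longrightarrow> simple_function M (s j (n::nat))"
      "\<And>j. j \<in> J \<Longrightarrow> AE x in M. (\<lambda>n. s j n x) \<longlonglongrightarrow> g j x" by blast
  define t where "t n = glue A {j\<in>I. num j < n} (\<lambda>j. s j n)" for n
  have disj': "disjoint_family_on A K" if "K \<subseteq> J" for K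
    using disj that by (auto simp: disjoint_family_on_def)
  have fin: "finite {j\<in>I. num j < n}" for n
    using inj_on_to_nat_on[OF I(1)] by (intro inj_on_finite[of num _ "{..<n}"])
      (auto simp: num_def inj_on_def)
  have simple_glue: "simple_function M (glue A K u)"
    if "finite K" "K \<subseteq> J" "\<And>j. j \<in> K \<Longrightarrow> simple_function M (u j)" for K u
    using that
  proof (induction K)
    case empty
    have "glue A {} u = (\<lambda>_. 0)" by (auto simp: glue_def)
    then show ?case by simp
  next
    case (insert j K)
    have "glue A (insert j K) u = (\<lambda>x. if x \<in> A j then u j x else glue A K u x)"
    proof
      fix x
      have d: "disjoint_family_on A (insert j K)" "disjoint_family_on A K"
        using insert.prems by (auto intro!: disj')
      show "glue A (insert j K) u x = (if x \<in> A j then u j x else glue A K u x)"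
      proof (cases "\<exists>i\<in>K. x \<in> A i \<and> x \<notin> A j")
        case True
        then obtain i where "i \<in> K" "x \<in> A i" "x \<notin> A j" by blast
        then show ?thesis using d by (simp add: glue_in)
      next
        case False
        then show ?thesis using d
          by (cases "x \<in> A j") (auto simp: glue_in intro!: trans[OF glue_out glue_out[symmetric]])
      qed
    qed
    moreover have "{x \<in> space M. x \<in> A j} \<in> sets M"
      using J(2)[of j] insert.prems by (simp add: Collect_conj_eq Int_def[symmetric])
    ultimately show ?case
      using insert by (auto intro!: simple_function_If)
  qed
  have "AE x in M. \<forall>j\<in>I. (\<lambda>n. s j n x) \<longlonglongrightarrow> g j x"
    using s(2) I by (subst AE_ball_countable) auto
  then have "AE x in M. (\<lambda>n. t n x) \<longlonglongrightarrow> glue A J g x"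
  proof eventually_elim
    case (elim x)
    show ?case
    proof (cases "\<exists>j\<in>J. x \<in> A j")
      case True
      then obtain j where j: "j \<in> J" "x \<in> A j" by blast
      then have jI: "j \<in> I" by (auto simp: I_def)
      have "eventually (\<lambda>n. s j n x = t n x) sequentially"
        using eventually_gt_at_top[of "num j"]
      proof eventually_elim
        case (elim n)
        have "disjoint_family_on A {j\<in>I. num j < n}" using I by (intro disj') auto
        then show ?case unfolding t_def using jI j elim by (subst glue_in) auto
      qed
      then have "(\<lambda>n. t n x) \<longlonglongrightarrow> g j x"
        using elim jI by (blast intro: Lim_transform_eventually)
      then show ?thesis using glue_in[OF disj j] by metis
    next
      case False
      then have "t n x = 0" for n
        using I by (auto simp: t_def intro!: glue_out)
      moreover have "glue A J g x = 0" using False by (auto intro!: glue_out)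
      ultimately show ?thesis by simp
    qed
  qed
  moreover have "simple_function M (t n)" for n
    unfolding t_def using fin I s(1) by (intro simple_glue) auto
  ultimately show ?thesis
    unfolding strongly_measurable_def by (intro exI[of _ t]) auto
qed

subsection \<open>p-integrable functions and their classes\<close>

text \<open>The p-th power of the seminorm, before the root: this quantity is additive over disjoint
  blocks, and in \<open>ennreal\<close> it makes sense before finiteness is known.\<close>

definition Lp_energy :: "'x measure \<Rightarrow> real \<Rightarrow> ('x \<Rightarrow> 'e::real_normed_vector) \<Rightarrow> ennreal" where
  "Lp_energy M p f = (\<integral>\<^sup>+x. ennreal (norm (f x) powr p) \<partial>M)"

text \<open>The form in which the operations on classes produce their results. Outside
  \<open>Lp_functions M p\<close> the class is empty, since \<open>ae_eq\<close> contains only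
  p-integrable pairs; hence the integrability conditions in the rules below.\<close>

definition Lp_class :: "'x measure \<Rightarrow> real \<Rightarrow> ('x \<Rightarrow> 'e::real_normed_vector) \<Rightarrow> ('x \<Rightarrow> 'e) set" where
  "Lp_class M p f = ae_eq M p `` {f}"

lemma Lp_functions_iff:
  "f \<in> Lp_functions M p \<longleftrightarrow> strongly_measurable M f \<and> Lp_energy M p f < \<infinity>"
  by (simp add: Lp_functions_def Lp_energy_def)

lemma borel_measurable_energy:
  assumes "strongly_measurable M f"
  shows "(\<lambda>x. ennreal (norm (f x) powr p)) \<in> borel_measurable (completion M)"
  using borel_measurable_norm_strongly_measurable[OF assms] by measurable

text \<open>The integral is a supremum over simple functions and does not change under completion,
  while additivity and monotone convergence become available for integrands that are measurable only
  there.\<close>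

lemma Lp_energy_completion:
  "Lp_energy M p f = (\<integral>\<^sup>+x. ennreal (norm (f x) powr p) \<partial>completion M)"
  by (simp add: Lp_energy_def nn_integral_completion)

lemma Lp_energy_mono_AE:
  assumes "AE x in M. norm (f x) \<le> norm (g x)" "0 \<le> p"
  shows "Lp_energy M p f \<le> Lp_energy M p g"
  unfolding Lp_energy_def
proof (rule nn_integral_mono_AE)
  show "AE x in M. ennreal (norm (f x) powr p) \<le> ennreal (norm (g x) powr p)"
    using assms(1) by eventually_elim (use assms(2) in \<open>simp add: ennreal_leI powr_mono2\<close>)
qed

lemma Lp_energy_cong_AE:
  assumes "AE x in M. f x = g x"
  shows "Lp_energy M p f = Lp_energy M p g"
  unfolding Lp_energy_def
proof (rule nn_integral_cong_AE)
  show "AE x in M. ennreal (norm (f x) powr p) = ennreal (norm (g x) powr p)"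
    using assms by eventually_elim simp
qed

lemma Lp_functions_cong_AE:
  assumes "f \<in> Lp_functions M p" "AE x in M. f x = g x"
  shows "g \<in> Lp_functions M p"
  using assms strongly_measurable_cong_AE[of M f g] Lp_energy_cong_AE[of f g M p]
  by (simp add: Lp_functions_iff)

lemma Lp_functions_zero: "(\<lambda>_. 0) \<in> Lp_functions M p"
  by (simp add: Lp_functions_iff Lp_energy_def strongly_measurable_const)

lemma Lp_functions_add:
  assumes f: "f \<in> Lp_functions M p" and g: "g \<in> Lp_functions M p" and p: "0 \<le> p"
  shows "(\<lambda>x. f x + g x) \<in> Lp_functions M p"
proof -
  have m: "strongly_measurable M (\<lambda>x. f x + g x)"
    using f g by (intro strongly_measurable_add) (auto simp: Lp_functions_iff)
  have mf: "(\<lambda>x. ennreal (norm (f x) powr p)) \<in> borel_measurable (completion M)"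
    and mg: "(\<lambda>x. ennreal (norm (g x) powr p)) \<in> borel_measurable (completion M)"
    using f g by (auto intro: borel_measurable_energy simp only: Lp_functions_iff)
  have "Lp_energy M p (\<lambda>x. f x + g x)
      \<le> (\<integral>\<^sup>+x. ennreal (2 powr p) * (ennreal (norm (f x) powr p) + ennreal (norm (g x) powr p))
            \<partial>completion M)"
    unfolding Lp_energy_completion
  proof (rule nn_integral_mono)
    fix x
    have "norm (f x + g x) powr p \<le> (norm (f x) + norm (g x)) powr p"
      using p by (intro powr_mono2 norm_triangle_ineq) auto
    also have "\<dots> \<le> 2 powr p * (norm (f x) powr p + norm (g x) powr p)"
      using p by (intro powr_add_le) auto
    finally show "ennreal (norm (f x + g x) powr p)
        \<le> ennreal (2 powr p) * (ennreal (norm (f x) powr p) + ennreal (norm (g x) powr p))"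
      by (simp add: ennreal_mult[symmetric] ennreal_plus[symmetric] ennreal_leI del: ennreal_plus)
  qed
  also have "\<dots> = ennreal (2 powr p) * (Lp_energy M p f + Lp_energy M p g)"
    unfolding Lp_energy_completion nn_integral_cmult[OF borel_measurable_add[OF mf mg]]
      nn_integral_add[OF mf mg] ..
  also have "\<dots> < \<infinity>"
    using f g by (auto simp: Lp_functions_iff ennreal_mult_less_top)
  finally show ?thesis using m by (simp add: Lp_functions_iff)
qed

lemma Lp_functions_mult:
  fixes f :: "'x \<Rightarrow> 'e::complex_banach"
  assumes f: "f \<in> Lp_functions M p" and \<phi>: "\<phi> \<in> borel_measurable M"
    and B: "\<And>x. cmod (\<phi> x) \<le> B" and p: "0 \<le> p"
  shows "(\<lambda>x. \<phi> x *\<^sub>C f x) \<in> Lp_functions M p"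
proof -
  have "Lp_energy M p (\<lambda>x. \<phi> x *\<^sub>C f x)
      \<le> (\<integral>\<^sup>+x. ennreal (B powr p) * ennreal (norm (f x) powr p) \<partial>completion M)"
    unfolding Lp_energy_completion
  proof (rule nn_integral_mono)
    fix x
    have "0 \<le> B" using B[of x] norm_ge_zero[of "\<phi> x"] by linarith
    then have "norm (\<phi> x *\<^sub>C f x) powr p \<le> B powr p * norm (f x) powr p"
      using B[of x] p by (simp add: norm_scaleC powr_mult mult_right_mono powr_mono2)
    then show "ennreal (norm (\<phi> x *\<^sub>C f x) powr p)
        \<le> ennreal (B powr p) * ennreal (norm (f x) powr p)"
      by (simp add: ennreal_mult[symmetric] ennreal_leI)
  qed
  also have "\<dots> = ennreal (B powr p) * Lp_energy M p f"
    using f unfolding Lp_energy_completion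
    by (intro nn_integral_cmult borel_measurable_energy) (simp add: Lp_functions_iff)
  also have "\<dots> < \<infinity>"
    using f by (auto simp: Lp_functions_iff ennreal_mult_less_top)
  finally show ?thesis
    using f \<phi> by (auto simp: Lp_functions_iff intro!: strongly_measurable_scaleC
        strongly_measurable_borel)
qed

lemma Lp_functions_diff:
  fixes f :: "'x \<Rightarrow> 'e::complex_banach"
  assumes "f \<in> Lp_functions M p" "g \<in> Lp_functions M p" "0 \<le> p"
  shows "(\<lambda>x. f x - g x) \<in> Lp_functions M p"
proof -
  have m1: "(-1) *\<^sub>C y = - y" for y :: 'e
    using scaleC_of_real[of "-1" y] by simp
  have "(\<lambda>x. f x + (-1) *\<^sub>C g x) \<in> Lp_functions M p"
    using assms by (intro Lp_functions_add Lp_functions_mult[where B = 1]) auto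
  then show ?thesis by (simp add: m1)
qed

lemma Lp_functions_sum:
  assumes "finite F" "\<And>j. j \<in> F \<Longrightarrow> f j \<in> Lp_functions M p" "0 \<le> p"
  shows "(\<lambda>x. \<Sum>j\<in>F. f j x) \<in> Lp_functions M p"
  using assms by (induction F) (simp_all add: Lp_functions_zero Lp_functions_add)

lemma Lp_class_iff:
  "g \<in> Lp_class M p f \<longleftrightarrow> f \<in> Lp_functions M p \<and> g \<in> Lp_functions M p \<and> (AE x in M. f x = g x)"
  by (auto simp: Lp_class_def ae_eq_def)

lemma Lp_class_self: "f \<in> Lp_functions M p \<Longrightarrow> f \<in> Lp_class M p f"
  by (simp add: Lp_class_iff)

lemma Lp_class_eq_iff:
  assumes "f \<in> Lp_functions M p" "g \<in> Lp_functions M p"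
  shows "Lp_class M p f = Lp_class M p g \<longleftrightarrow> (AE x in M. f x = g x)"
proof
  assume "Lp_class M p f = Lp_class M p g"
  then show "AE x in M. f x = g x"
    using Lp_class_self[OF assms(2)] by (metis Lp_class_iff)
next
  assume fg: "AE x in M. f x = g x"
  have "(AE x in M. f x = h x) \<longleftrightarrow> (AE x in M. g x = h x)" for h
  proof
    assume "AE x in M. f x = h x"
    with fg show "AE x in M. g x = h x" by eventually_elim simp
  next
    assume "AE x in M. g x = h x"
    with fg show "AE x in M. f x = h x" by eventually_elim simp
  qed
  then have "h \<in> Lp_class M p f \<longleftrightarrow> h \<in> Lp_class M p g" for h
    unfolding Lp_class_iff using assms by blast
  then show "Lp_class M p f = Lp_class M p g" by blast
qed

lemma Lp_class_cong_AE:
  assumes "f \<in> Lp_functions M p" "AE x in M. f x = g x"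
  shows "Lp_class M p g = Lp_class M p f"
  using Lp_class_eq_iff[OF assms(1) Lp_functions_cong_AE[OF assms]] assms(2) by blast

lemma Lp_class_in: "f \<in> Lp_functions M p \<Longrightarrow> Lp_class M p f \<in> Lp M p"
  by (auto simp: Lp_def Lp_class_def intro: quotientI)

lemma Lp_cases:
  assumes "u \<in> Lp M p"
  obtains f where "f \<in> Lp_functions M p" "u = Lp_class M p f"
  using assms by (auto simp: Lp_def Lp_class_def elim: quotientE)

lemma Lp_seminorm_energy: "Lp_seminorm M p f = enn2real (Lp_energy M p f) powr (1 / p)"
  by (simp add: Lp_seminorm_def Lp_energy_def)

lemma Lp_norm_class:
  assumes "f \<in> Lp_functions M p"
  shows "Lp_norm M p (Lp_class M p f) = Lp_seminorm M p f"
proof -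
  have "Lp_seminorm M p ` Lp_class M p f = {Lp_seminorm M p f}"
    using Lp_class_self[OF assms] Lp_energy_cong_AE[of f _ M p]
    by (auto simp: Lp_class_iff Lp_seminorm_energy image_iff intro!: bexI[of _ f])
  then show ?thesis by (simp add: Lp_norm_def)
qed

lemma Lp_energy_eq_seminorm:
  assumes "f \<in> Lp_functions M p" "0 < p"
  shows "Lp_energy M p f = ennreal (Lp_seminorm M p f powr p)"
  using assms by (simp add: Lp_seminorm_energy powr_powr Lp_functions_iff)

lemma Lp_seminorm_le_iff:
  assumes "f \<in> Lp_functions M p" "0 < p" "0 \<le> c"
  shows "Lp_seminorm M p f \<le> c \<longleftrightarrow> Lp_energy M p f \<le> ennreal (c powr p)"
proof -
  have "0 \<le> Lp_seminorm M p f" by (simp add: Lp_seminorm_energy)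
  then have "Lp_seminorm M p f \<le> c \<longleftrightarrow> Lp_seminorm M p f powr p \<le> c powr p"
    using assms powr_mono2[of p "Lp_seminorm M p f" c] powr_less_mono2[of p c "Lp_seminorm M p f"]
    by linarith
  then show ?thesis using assms by (simp add: Lp_energy_eq_seminorm)
qed

lemma Lp_add_class:
  assumes f: "f \<in> Lp_functions M p" and g: "g \<in> Lp_functions M p" and p: "0 \<le> p"
  shows "Lp_add M p (Lp_class M p f) (Lp_class M p g) = Lp_class M p (\<lambda>x. f x + g x)"
proof -
  have "Lp_class M p (\<lambda>x. f' x + g' x) = Lp_class M p (\<lambda>x. f x + g x)"
    if "f' \<in> Lp_class M p f" "g' \<in> Lp_class M p g" for f' g'
  proof (rule Lp_class_cong_AE)
    have "AE x in M. f x = f' x" "AE x in M. g x = g' x"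
      using that unfolding Lp_class_iff by blast+
    then show "AE x in M. f x + g x = f' x + g' x"
      by eventually_elim simp
  qed (fact Lp_functions_add[OF assms])
  then show ?thesis
    unfolding Lp_add_def Lp_class_def[symmetric]
    using Lp_class_self[OF f] Lp_class_self[OF g] by blast
qed

lemma Lp_diff_class:
  fixes f :: "'x \<Rightarrow> 'e::complex_banach"
  assumes f: "f \<in> Lp_functions M p" and g: "g \<in> Lp_functions M p" and p: "0 \<le> p"
  shows "Lp_diff M p (Lp_class M p f) (Lp_class M p g) = Lp_class M p (\<lambda>x. f x - g x)"
proof -
  have "Lp_class M p (\<lambda>x. f' x - g' x) = Lp_class M p (\<lambda>x. f x - g x)"
    if "f' \<in> Lp_class M p f" "g' \<in> Lp_class M p g" for f' g'
  proof (rule Lp_class_cong_AE)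
    have "AE x in M. f x = f' x" "AE x in M. g x = g' x"
      using that unfolding Lp_class_iff by blast+
    then show "AE x in M. f x - g x = f' x - g' x"
      by eventually_elim simp
  qed (fact Lp_functions_diff[OF assms])
  then show ?thesis
    unfolding Lp_diff_def Lp_class_def[symmetric]
    using Lp_class_self[OF f] Lp_class_self[OF g] by blast
qed

lemma Lp_mult_class:
  fixes f :: "'x \<Rightarrow> 'e::complex_banach"
  assumes f: "f \<in> Lp_functions M p" and \<phi>: "\<phi> \<in> borel_measurable M"
    and B: "\<And>x. cmod (\<phi> x) \<le> B" and p: "0 \<le> p"
  shows "Lp_mult M p \<phi> (Lp_class M p f) = Lp_class M p (\<lambda>x. \<phi> x *\<^sub>C f x)"
proof -
  have "Lp_class M p (\<lambda>x. \<phi> x *\<^sub>C f' x) = Lp_class M p (\<lambda>x. \<phi> x *\<^sub>C f x)"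
    if "f' \<in> Lp_class M p f" for f'
  proof (rule Lp_class_cong_AE)
    have "AE x in M. f x = f' x"
      using that unfolding Lp_class_iff by blast
    then show "AE x in M. \<phi> x *\<^sub>C f x = \<phi> x *\<^sub>C f' x"
      by eventually_elim simp
  qed (fact Lp_functions_mult[OF assms])
  then show ?thesis
    unfolding Lp_mult_def Lp_class_def[symmetric] using Lp_class_self[OF f] by blast
qed

text \<open>A family in \<open>Pi F\<close> is arbitrary outside \<open>F\<close>, where the sum
  does not look; inside, finitely many null sets are united.\<close>

lemma Lp_sum_class:
  assumes F: "finite F" and f: "\<And>j. j \<in> F \<Longrightarrow> f j \<in> Lp_functions M p" and p: "0 \<le> p"
  shows "Lp_sum M p F (\<lambda>j. Lp_class M p (f j)) = Lp_class M p (\<lambda>x. \<Sum>j\<in>F. f j x)"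
proof -
  have sum_Lp: "(\<lambda>x. \<Sum>j\<in>F. f j x) \<in> Lp_functions M p"
    using assms by (rule Lp_functions_sum)
  have "Lp_class M p (\<lambda>x. \<Sum>j\<in>F. g j x) = Lp_class M p (\<lambda>x. \<Sum>j\<in>F. f j x)"
    if g: "g \<in> Pi F (\<lambda>j. Lp_class M p (f j))" for g
  proof -
    have 1: "AE x in M. f j x = g j x" if "j \<in> F" for j
      using Pi_mem[OF g that] unfolding Lp_class_iff by blast
    have 2: "AE x in M. \<forall>j\<in>F. f j x = g j x"
      using F 1 by (rule AE_finite_allI)
    have 3: "AE x in M. (\<Sum>j\<in>F. f j x) = (\<Sum>j\<in>F. g j x)"
      using 2 by eventually_elim simp
    show ?thesis by (rule Lp_class_cong_AE[OF sum_Lp 3])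
  qed
  moreover have "f \<in> Pi F (\<lambda>j. Lp_class M p (f j))"
    using f by (auto intro: Lp_class_self)
  ultimately show ?thesis
    unfolding Lp_sum_def Lp_class_def[symmetric] by blast
qed

subsection \<open>Bounded operators on representatives\<close>

locale Lp_operator =
  fixes M :: "'x measure" and p :: real
    and a :: "('x \<Rightarrow> 'e::complex_banach) set \<Rightarrow> ('x \<Rightarrow> 'e) set"
  assumes p_ge_1: "1 \<le> p" and bounded_a: "a \<in> Lp_bounded_operators M p"
begin

lemma p_pos: "0 < p" "0 \<le> p" using p_ge_1 by auto

text \<open>A version of \<open>a\<close> on functions, so that values at points can be compared.
  The price is that linearity holds up to null sets depending on the arguments.\<close>

definition rep :: "('x \<Rightarrow> 'e) \<Rightarrow> 'x \<Rightarrow> 'e" where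
  "rep f = (SOME g. g \<in> a (Lp_class M p f))"

lemma
  assumes "f \<in> Lp_functions M p"
  shows rep_Lp: "rep f \<in> Lp_functions M p"
    and a_class: "a (Lp_class M p f) = Lp_class M p (rep f)"
proof -
  have "a (Lp_class M p f) \<in> Lp M p"
    using bounded_a Lp_class_in[OF assms] by (auto simp: Lp_bounded_operators_def)
  then obtain g where g: "g \<in> Lp_functions M p" "a (Lp_class M p f) = Lp_class M p g"
    by (elim Lp_cases)
  then have "rep f \<in> Lp_class M p g"
    unfolding rep_def by (metis Lp_class_self someI_ex)
  then have r: "rep f \<in> Lp_functions M p" "AE x in M. g x = rep f x"
    by (auto simp: Lp_class_iff)
  show "rep f \<in> Lp_functions M p" by fact
  show "a (Lp_class M p f) = Lp_class M p (rep f)"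
    using g Lp_class_cong_AE[OF g(1) r(2)] by simp
qed

lemma rep_cong:
  assumes "f \<in> Lp_functions M p" "AE x in M. f x = g x"
  shows "AE x in M. rep f x = rep g x"
proof -
  have g: "g \<in> Lp_functions M p" using assms by (rule Lp_functions_cong_AE)
  have "Lp_class M p (rep f) = Lp_class M p (rep g)"
    using Lp_class_cong_AE[OF assms] a_class[OF assms(1)] a_class[OF g] by simp
  then show ?thesis
    using assms g by (simp add: Lp_class_eq_iff rep_Lp)
qed

lemma scale_Lp:
  assumes "f \<in> Lp_functions M p"
  shows "(\<lambda>x. c *\<^sub>C f x) \<in> Lp_functions M p"
  using assms p_pos by (intro Lp_functions_mult[where B = "cmod c"]) auto

lemma rep_scale:
  assumes f: "f \<in> Lp_functions M p"
  shows "AE x in M. rep (\<lambda>x. c *\<^sub>C f x) x = c *\<^sub>C rep f x"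
proof -
  have m: "Lp_mult M p (\<lambda>_. c) (Lp_class M p g) = Lp_class M p (\<lambda>x. c *\<^sub>C g x)"
    if "g \<in> Lp_functions M p" for g :: "'x \<Rightarrow> 'e"
    using that p_pos by (intro Lp_mult_class[where B = "cmod c"]) auto
  have "a (Lp_mult M p (\<lambda>_. c) (Lp_class M p f)) = Lp_mult M p (\<lambda>_. c) (a (Lp_class M p f))"
    using bounded_a Lp_class_in[OF f] by (auto simp: Lp_bounded_operators_def)
  then have "Lp_class M p (rep (\<lambda>x. c *\<^sub>C f x)) = Lp_class M p (\<lambda>x. c *\<^sub>C rep f x)"
    using f by (simp add: m a_class rep_Lp scale_Lp)
  then show ?thesis
    using f by (simp add: Lp_class_eq_iff rep_Lp scale_Lp)
qed

lemma rep_add: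
  assumes f: "f \<in> Lp_functions M p" and g: "g \<in> Lp_functions M p"
  shows "AE x in M. rep (\<lambda>x. f x + g x) x = rep f x + rep g x"
proof -
  have "a (Lp_add M p (Lp_class M p f) (Lp_class M p g))
      = Lp_add M p (a (Lp_class M p f)) (a (Lp_class M p g))"
    using bounded_a Lp_class_in[OF f] Lp_class_in[OF g] by (auto simp: Lp_bounded_operators_def)
  then have "Lp_class M p (rep (\<lambda>x. f x + g x)) = Lp_class M p (\<lambda>x. rep f x + rep g x)"
    using assms p_pos by (simp add: Lp_add_class a_class rep_Lp Lp_functions_add)
  then show ?thesis
    using assms p_pos by (simp add: Lp_class_eq_iff rep_Lp Lp_functions_add)
qed

lemma rep_sum:
  assumes "finite I" "\<And>i. i \<in> I \<Longrightarrow> f i \<in> Lp_functions M p"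
  shows "AE x in M. rep (\<lambda>x. \<Sum>i\<in>I. c i *\<^sub>C f i x) x = (\<Sum>i\<in>I. c i *\<^sub>C rep (f i) x)"
  using assms
proof (induction I)
  case empty
  show ?case using rep_scale[OF Lp_functions_zero, of 0] by (simp add: scaleC.zero_left)
next
  case (insert i I)
  have "AE x in M. rep (\<lambda>x. c i *\<^sub>C f i x + (\<Sum>i\<in>I. c i *\<^sub>C f i x)) x
      = rep (\<lambda>x. c i *\<^sub>C f i x) x + rep (\<lambda>x. \<Sum>i\<in>I. c i *\<^sub>C f i x) x"
    using insert.prems p_pos insert.hyps
    by (intro rep_add Lp_functions_sum scale_Lp) auto
  moreover have "AE x in M. rep (\<lambda>x. c i *\<^sub>C f i x) x = c i *\<^sub>C rep (f i) x"
    using insert.prems by (intro rep_scale) auto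
  moreover have "AE x in M. rep (\<lambda>x. \<Sum>i\<in>I. c i *\<^sub>C f i x) x = (\<Sum>i\<in>I. c i *\<^sub>C rep (f i) x)"
    using insert by auto
  ultimately show ?case
    by eventually_elim (use insert.hyps in simp)
qed

lemma rep_energy_bound:
  obtains C where "0 \<le> C"
    "\<And>f :: 'x \<Rightarrow> 'e. f \<in> Lp_functions M p \<Longrightarrow> Lp_energy M p (rep f) \<le> ennreal (C powr p) * Lp_energy M p f"
proof -
  obtain C where "\<forall>u\<in>Lp M p. Lp_norm M p (a u) \<le> C * Lp_norm M p u"
    using bounded_a unfolding Lp_bounded_operators_def by blast
  then have C: "Lp_norm M p (a u) \<le> C * Lp_norm M p u" if "u \<in> Lp M p" for u
    using that by blast
  show thesis
  proof
    \<comment> \<open>A constant in \<open>Lp_bounded_operators\<close> may be negative, and its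
      p-th power is taken below.\<close>
    show "0 \<le> \<bar>C\<bar>" by simp
    fix f :: "'x \<Rightarrow> 'e" assume f: "f \<in> Lp_functions M p"
    have nn: "0 \<le> Lp_seminorm M p f" by (simp add: Lp_seminorm_energy)
    have "Lp_seminorm M p (rep f) \<le> C * Lp_seminorm M p f"
      using C[OF Lp_class_in[OF f]] f by (simp add: a_class rep_Lp Lp_norm_class)
    also have "\<dots> \<le> \<bar>C\<bar> * Lp_seminorm M p f"
      using nn by (intro mult_right_mono) auto
    finally have "Lp_energy M p (rep f) \<le> ennreal ((\<bar>C\<bar> * Lp_seminorm M p f) powr p)"
      using f nn p_pos by (subst (asm) Lp_seminorm_le_iff) (auto simp: rep_Lp)
    also have "\<dots> = ennreal (\<bar>C\<bar> powr p) * Lp_energy M p f"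
      using f nn p_pos by (simp add: Lp_energy_eq_seminorm powr_mult ennreal_mult)
    finally show "Lp_energy M p (rep f) \<le> ennreal (\<bar>C\<bar> powr p) * Lp_energy M p f" .
  qed
qed

end

text \<open>Only the exceptional sets of nonempty blocks matter, and a countable union of null sets
  is null.\<close>

lemma AE_blocks:
  assumes "countable {j\<in>J. A j \<noteq> {}}" "\<And>j. j \<in> J \<Longrightarrow> AE x in M. x \<in> A j \<longrightarrow> P x"
  shows "AE x in M. (\<exists>j\<in>J. x \<in> A j) \<longrightarrow> P x"
proof -
  have "AE x in M. \<forall>j\<in>{j\<in>J. A j \<noteq> {}}. x \<in> A j \<longrightarrow> P x"
    using assms by (subst AE_ball_countable) auto
  then show ?thesis by eventually_elim auto
qed

text \<open>When \<open>B\<close> runs through the subsets of \<open>F\<close>, the signs of the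
  indices in \<open>F\<close> are independent Rademacher signs, realised by counting; the sign of
  any other index is constantly -1.\<close>

definition sign_of :: "'j set \<Rightarrow> 'j \<Rightarrow> complex" where
  "sign_of B k = (if k \<in> B then 1 else -1)"

lemma sign_of_simps [simp]: "sign_of B k * sign_of B k = 1" "cmod (sign_of B k) = 1"
  by (auto simp: sign_of_def)

text \<open>Toggling the membership of j in \<open>B\<close> is an involution of
  \<open>Pow F\<close> that flips the sign of j and keeps that of k. The index k may lie outside
  \<open>F\<close>.\<close>

lemma sum_sign_of:
  assumes "finite F" "j \<in> F"
  shows "(\<Sum>B\<in>Pow F. sign_of B j * sign_of B k) = (if k = j then of_nat (card (Pow F)) else 0)"
proof (cases "k = j")
  case False
  define T where "T B = (if j \<in> B then B - {j} else insert j B)" for B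
  have T: "T B \<in> Pow F" "T (T B) = B" "sign_of (T B) j * sign_of (T B) k = - (sign_of B j * sign_of B k)"
    if "B \<in> Pow F" for B
    using that assms False by (auto simp: T_def sign_of_def)
  have "(\<Sum>B\<in>Pow F. sign_of B j * sign_of B k) = (\<Sum>B\<in>Pow F. - (sign_of B j * sign_of B k))"
    by (rule sum.reindex_bij_witness[of _ T T]) (use T in auto)
  then show ?thesis using False by (simp add: sum_negf)
qed simp

subsection \<open>Block diagonal parts\<close>

text \<open>This separates the integral estimates from the geometry: properness, separation and
  Lipschitz functions enter only through the interpretation and through the sign functions assumed
  in \<open>off_diagonal_energy\<close>.\<close>

locale Lp_blocks = Lp_operator M p a
  for M :: "'x measure" and p :: real
    and a :: "('x \<Rightarrow> 'e::complex_banach) set \<Rightarrow> ('x \<Rightarrow> 'e) set" +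
  fixes A :: "'j \<Rightarrow> 'x set" and J :: "'j set" and \<phi> :: "'j \<Rightarrow> 'x \<Rightarrow> complex"
  assumes disjoint: "disjoint_family_on A J"
    and countable_blocks: "countable {j\<in>J. A j \<noteq> {}}"
    and sets_A: "\<And>j. j \<in> J \<Longrightarrow> A j \<in> sets M"
    and \<phi>_borel: "\<And>j. j \<in> J \<Longrightarrow> \<phi> j \<in> borel_measurable M"
    and \<phi>_le_1: "\<And>j x. j \<in> J \<Longrightarrow> cmod (\<phi> j x) \<le> 1"
    and \<phi>_zero: "\<And>j x. j \<in> J \<Longrightarrow> x \<notin> A j \<Longrightarrow> \<phi> j x = 0"
begin

abbreviation corner :: "('x \<Rightarrow> 'e) \<Rightarrow> 'j \<Rightarrow> 'x \<Rightarrow> 'e" where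
  "corner f j x \<equiv> \<phi> j x *\<^sub>C rep (\<lambda>x. \<phi> j x *\<^sub>C f x) x"

text \<open>A representative of the sum of all \<open>e\<^sub>j a e\<^sub>j f\<close>: each corner
  vanishes off its block, so at most one term survives at a point.\<close>

definition diag :: "('x \<Rightarrow> 'e) \<Rightarrow> 'x \<Rightarrow> 'e" where
  "diag f = glue A J (corner f)"

text \<open>The choice of representative is harmless by \<open>diag_cong\<close>;
  \<open>diag_op_class\<close> removes it.\<close>

definition diag_op :: "('x \<Rightarrow> 'e) set \<Rightarrow> ('x \<Rightarrow> 'e) set" where
  "diag_op u = Lp_class M p (diag (SOME f. f \<in> u))"

lemma \<phi>_Lp: "f \<in> Lp_functions M p \<Longrightarrow> j \<in> J \<Longrightarrow> (\<lambda>x. \<phi> j x *\<^sub>C f x) \<in> Lp_functions M p"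
  using \<phi>_borel \<phi>_le_1 p_pos by (intro Lp_functions_mult[where B = 1]) auto

lemma corner_Lp: "f \<in> Lp_functions M p \<Longrightarrow> j \<in> J \<Longrightarrow> corner f j \<in> Lp_functions M p"
  by (intro \<phi>_Lp rep_Lp)

lemma diag_in: "j \<in> J \<Longrightarrow> x \<in> A j \<Longrightarrow> diag f x = corner f j x"
  unfolding diag_def by (rule glue_in[OF disjoint])

lemma diag_out: "\<not> (\<exists>j\<in>J. x \<in> A j) \<Longrightarrow> diag f x = 0"
  unfolding diag_def by (rule glue_out) auto

lemma strongly_measurable_diag: "f \<in> Lp_functions M p \<Longrightarrow> strongly_measurable M (diag f)"
  unfolding diag_def using corner_Lp
  by (intro strongly_measurable_glue disjoint countable_blocks sets_A) (auto simp: Lp_functions_iff)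

text \<open>At a given point only the block containing it can contribute, so the sum has at most one
  nonzero term.\<close>

lemma sum_blocks_le:
  fixes b :: "'j \<Rightarrow> ennreal"
  assumes "finite F" "F \<subseteq> J" "\<And>j. j \<in> F \<Longrightarrow> b j \<le> c" "\<And>j. j \<in> F \<Longrightarrow> x \<notin> A j \<Longrightarrow> b j = 0"
  shows "(\<Sum>j\<in>F. b j) \<le> c"
proof (cases "\<exists>i\<in>F. x \<in> A i")
  case True
  then obtain i where i: "i \<in> F" "x \<in> A i" by blast
  have "b j = 0" if "j \<in> F - {i}" for j
    using that i assms(2) disjoint_family_onD[OF disjoint, of i j] by (intro assms(4)) auto
  then have "(\<Sum>j\<in>F. b j) = b i"
    using assms(1) i by (simp add: sum.remove)
  then show ?thesis using assms(3) i by simp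
next
  case False
  then have "(\<Sum>j\<in>F. b j) = 0" using assms(4) by (intro sum.neutral) auto
  then show ?thesis by simp
qed

lemma energy_le_blocks:
  assumes f: "strongly_measurable M f" and out: "\<And>x. \<not> (\<exists>j\<in>J. x \<in> A j) \<Longrightarrow> f x = 0"
    and bound: "\<And>F. finite F \<Longrightarrow> F \<subseteq> J \<Longrightarrow>
      (\<integral>\<^sup>+x. ennreal (norm (f x) powr p) * indicator (\<Union>j\<in>F. A j) x \<partial>completion M) \<le> c"
  shows "Lp_energy M p f \<le> c"
proof -
  have "Lp_energy M p f
      = (\<integral>\<^sup>+x. ennreal (norm (f x) powr p) * indicator (\<Union>j\<in>J. A j) x \<partial>completion M)"
    unfolding Lp_energy_completion
    by (intro nn_integral_cong) (auto simp: indicator_def out)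
  also have "\<dots> \<le> c"
    by (rule nn_integral_UN_le[OF borel_measurable_energy[OF f] countable_blocks])
      (simp_all add: sets_A bound)
  finally show ?thesis .
qed

text \<open>Apply the bound for \<open>a\<close> to each \<open>\<phi> j\<close> times
  \<open>f\<close> and add p-th powers. The inner multipliers live on disjoint blocks, so the
  constant of \<open>a\<close> is kept.\<close>

lemma diag_energy_bound:
  obtains C where "0 \<le> C"
    "\<And>f :: 'x \<Rightarrow> 'e. f \<in> Lp_functions M p \<Longrightarrow> Lp_energy M p (diag f) \<le> ennreal (C powr p) * Lp_energy M p f"
proof -
  obtain C where C: "0 \<le> C"
    "\<And>f :: 'x \<Rightarrow> 'e. f \<in> Lp_functions M p \<Longrightarrow> Lp_energy M p (rep f) \<le> ennreal (C powr p) * Lp_energy M p f"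
    using rep_energy_bound by blast
  show thesis
  proof
    show "0 \<le> C" by fact
    fix f :: "'x \<Rightarrow> 'e" assume f: "f \<in> Lp_functions M p"
    show "Lp_energy M p (diag f) \<le> ennreal (C powr p) * Lp_energy M p f"
    proof (rule energy_le_blocks)
      show "strongly_measurable M (diag f)" using f by (rule strongly_measurable_diag)
      fix F assume F: "finite F" "F \<subseteq> J"
      let ?W = "completion M"
      let ?r = "\<lambda>j. rep (\<lambda>x. \<phi> j x *\<^sub>C f x)"
      have r: "strongly_measurable M (?r j)" "strongly_measurable M (\<lambda>x. \<phi> j x *\<^sub>C f x)" if "j \<in> F" for j
        using rep_Lp[OF \<phi>_Lp[OF f]] \<phi>_Lp[OF f] that F by (auto simp: Lp_functions_iff)
      \<comment> \<open>The outer multiplier is dropped and the single term of the block is enlarged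
        to the sum over \<open>F\<close>; the functions \<open>?r j\<close> need not be localised,
        since only the sum of their energies is used.\<close>
      have "(\<integral>\<^sup>+x. ennreal (norm (diag f x) powr p) * indicator (\<Union>j\<in>F. A j) x \<partial>?W)
          \<le> (\<integral>\<^sup>+x. (\<Sum>j\<in>F. ennreal (norm (?r j x) powr p)) \<partial>?W)"
      proof (rule nn_integral_mono)
        fix x
        show "ennreal (norm (diag f x) powr p) * indicator (\<Union>j\<in>F. A j) x
            \<le> (\<Sum>j\<in>F. ennreal (norm (?r j x) powr p))"
        proof (cases "\<exists>j\<in>F. x \<in> A j")
          case True
          then obtain j where j: "j \<in> F" "x \<in> A j" by blast
          then have "norm (diag f x) \<le> norm (?r j x)"
            using F \<phi>_le_1[of j x] by (auto simp: diag_in norm_scaleC mult_left_le_one_le)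
          then have "ennreal (norm (diag f x) powr p) \<le> ennreal (norm (?r j x) powr p)"
            using p_pos by (intro ennreal_leI powr_mono2) auto
          also have "\<dots> \<le> (\<Sum>j\<in>F. ennreal (norm (?r j x) powr p))"
            using F j by (intro member_le_sum) auto
          finally show ?thesis by (simp add: indicator_def)
        qed (auto simp: indicator_def)
      qed
      also have "\<dots> = (\<Sum>j\<in>F. Lp_energy M p (?r j))"
        using r unfolding Lp_energy_completion
        by (intro nn_integral_sum borel_measurable_energy)
      also have "\<dots> \<le> (\<Sum>j\<in>F. ennreal (C powr p) * Lp_energy M p (\<lambda>x. \<phi> j x *\<^sub>C f x))"
        using F \<phi>_Lp[OF f] by (intro sum_mono C(2)) auto
      also have "\<dots> = ennreal (C powr p) * (\<integral>\<^sup>+x. (\<Sum>j\<in>F. ennreal (norm (\<phi> j x *\<^sub>C f x) powr p)) \<partial>?W)"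
        using r unfolding Lp_energy_completion sum_distrib_left[symmetric]
        by (subst nn_integral_sum) (rule borel_measurable_energy, blast, rule refl)
      \<comment> \<open>Here disjointness pays: at each point at most one of the functions
        \<open>\<phi> j\<close> times \<open>f\<close> is nonzero.\<close>
      also have "\<dots> \<le> ennreal (C powr p) * Lp_energy M p f"
        unfolding Lp_energy_completion
      proof (intro mult_left_mono nn_integral_mono)
        fix x
        show "(\<Sum>j\<in>F. ennreal (norm (\<phi> j x *\<^sub>C f x) powr p)) \<le> ennreal (norm (f x) powr p)"
        proof (rule sum_blocks_le[OF F])
          fix j assume j: "j \<in> F"
          have "norm (\<phi> j x *\<^sub>C f x) \<le> norm (f x)"
            using F j \<phi>_le_1[of j x] by (auto simp: norm_scaleC mult_left_le_one_le)
          then show "ennreal (norm (\<phi> j x *\<^sub>C f x) powr p) \<le> ennreal (norm (f x) powr p)"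
            using p_pos by (intro ennreal_leI powr_mono2) auto
          show "ennreal (norm (\<phi> j x *\<^sub>C f x) powr p) = 0" if "x \<notin> A j"
            using \<phi>_zero[of j x] that F j by (auto simp: scaleC.zero_left)
        qed
      qed simp
      finally show "(\<integral>\<^sup>+x. ennreal (norm (diag f x) powr p) * indicator (\<Union>j\<in>F. A j) x \<partial>?W)
          \<le> ennreal (C powr p) * Lp_energy M p f" .
    qed (rule diag_out)
  qed
qed

lemma diag_Lp:
  assumes "f \<in> Lp_functions M p"
  shows "diag f \<in> Lp_functions M p"
proof -
  obtain C where C: "Lp_energy M p (diag f) \<le> ennreal (C powr p) * Lp_energy M p f"
    using diag_energy_bound assms by metis
  also have "\<dots> < \<infinity>" using assms by (simp add: Lp_functions_iff ennreal_mult_less_top)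
  finally show ?thesis
    using strongly_measurable_diag[OF assms] by (simp add: Lp_functions_iff)
qed

lemma diag_cong:
  assumes f: "f \<in> Lp_functions M p" and fg: "AE x in M. f x = g x"
  shows "AE x in M. diag f x = diag g x"
proof -
  have "AE x in M. (\<exists>j\<in>J. x \<in> A j) \<longrightarrow> diag f x = diag g x"
  proof (rule AE_blocks[OF countable_blocks])
    fix j assume j: "j \<in> J"
    have "AE x in M. \<phi> j x *\<^sub>C f x = \<phi> j x *\<^sub>C g x"
      using fg by eventually_elim simp
    with \<phi>_Lp[OF f j] have "AE x in M. rep (\<lambda>x. \<phi> j x *\<^sub>C f x) x = rep (\<lambda>x. \<phi> j x *\<^sub>C g x) x"
      by (rule rep_cong)
    then show "AE x in M. x \<in> A j \<longrightarrow> diag f x = diag g x"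
      by eventually_elim (simp add: diag_in[OF j])
  qed
  then show ?thesis by eventually_elim (metis diag_out)
qed

lemma diag_add:
  assumes f: "f \<in> Lp_functions M p" and g: "g \<in> Lp_functions M p"
  shows "AE x in M. diag (\<lambda>x. f x + g x) x = diag f x + diag g x"
proof -
  have "AE x in M. (\<exists>j\<in>J. x \<in> A j) \<longrightarrow> diag (\<lambda>x. f x + g x) x = diag f x + diag g x"
  proof (rule AE_blocks[OF countable_blocks])
    fix j assume j: "j \<in> J"
    show "AE x in M. x \<in> A j \<longrightarrow> diag (\<lambda>x. f x + g x) x = diag f x + diag g x"
      using rep_add[OF \<phi>_Lp[OF f j] \<phi>_Lp[OF g j]]
      by eventually_elim (simp add: diag_in[OF j] scaleC.add_right)
  qed
  then show ?thesis by eventually_elim (metis diag_out add.right_neutral)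
qed

lemma diag_scale:
  assumes f: "f \<in> Lp_functions M p"
  shows "AE x in M. diag (\<lambda>x. c *\<^sub>C f x) x = c *\<^sub>C diag f x"
proof -
  have "AE x in M. (\<exists>j\<in>J. x \<in> A j) \<longrightarrow> diag (\<lambda>x. c *\<^sub>C f x) x = c *\<^sub>C diag f x"
  proof (rule AE_blocks[OF countable_blocks])
    fix j assume j: "j \<in> J"
    show "AE x in M. x \<in> A j \<longrightarrow> diag (\<lambda>x. c *\<^sub>C f x) x = c *\<^sub>C diag f x"
      using rep_scale[OF \<phi>_Lp[OF f j], of c]
      by eventually_elim (simp add: diag_in[OF j] scaleC_scaleC mult.commute)
  qed
  then show ?thesis by eventually_elim (metis diag_out scaleC.zero_right)
qed

lemma diag_op_class:
  assumes f: "f \<in> Lp_functions M p"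
  shows "diag_op (Lp_class M p f) = Lp_class M p (diag f)"
proof -
  have "(SOME g. g \<in> Lp_class M p f) \<in> Lp_class M p f"
    using Lp_class_self[OF f] by (rule someI[where P = "\<lambda>g. g \<in> Lp_class M p f"])
  then have "AE x in M. diag f x = diag (SOME g. g \<in> Lp_class M p f) x"
    using diag_cong[OF f] unfolding Lp_class_iff by blast
  then show ?thesis
    unfolding diag_op_def by (rule Lp_class_cong_AE[OF diag_Lp[OF f]])
qed

lemma diag_op_bounded: "diag_op \<in> Lp_bounded_operators M p"
  unfolding Lp_bounded_operators_def
proof (intro CollectI conjI ballI allI)
  show "diag_op \<in> Lp M p \<rightarrow> Lp M p"
    by (auto elim!: Lp_cases simp: diag_op_class diag_Lp Lp_class_in)
next
  fix u v :: "('x \<Rightarrow> 'e) set" assume "u \<in> Lp M p" "v \<in> Lp M p"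
  then obtain f g where f: "f \<in> Lp_functions M p" "u = Lp_class M p f"
    and g: "g \<in> Lp_functions M p" "v = Lp_class M p g" by (elim Lp_cases)
  show "diag_op (Lp_add M p u v) = Lp_add M p (diag_op u) (diag_op v)"
    using f g p_pos diag_add[OF f(1) g(1)]
    by (simp add: Lp_add_class diag_op_class diag_Lp Lp_functions_add Lp_class_eq_iff)
next
  fix c and u :: "('x \<Rightarrow> 'e) set" assume "u \<in> Lp M p"
  then obtain f where f: "f \<in> Lp_functions M p" "u = Lp_class M p f" by (elim Lp_cases)
  have m: "Lp_mult M p (\<lambda>_. c) (Lp_class M p g) = Lp_class M p (\<lambda>x. c *\<^sub>C g x)"
    if "g \<in> Lp_functions M p" for g :: "'x \<Rightarrow> 'e"
    using that p_pos by (intro Lp_mult_class[where B = "cmod c"]) auto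
  show "diag_op (Lp_mult M p (\<lambda>_. c) u) = Lp_mult M p (\<lambda>_. c) (diag_op u)"
    using f diag_scale[OF f(1), of c]
    by (simp add: m diag_op_class diag_Lp scale_Lp Lp_class_eq_iff)
next
  obtain C where C: "0 \<le> C"
    "\<And>f :: 'x \<Rightarrow> 'e. f \<in> Lp_functions M p \<Longrightarrow> Lp_energy M p (diag f) \<le> ennreal (C powr p) * Lp_energy M p f"
    using diag_energy_bound by blast
  show "\<exists>C. \<forall>u\<in>Lp M p. Lp_norm M p (diag_op u) \<le> C * Lp_norm M p u"
  proof (intro exI[of _ C] ballI)
    fix u :: "('x \<Rightarrow> 'e) set" assume "u \<in> Lp M p"
    then obtain f where f: "f \<in> Lp_functions M p" "u = Lp_class M p f" by (elim Lp_cases)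
    have nn: "0 \<le> Lp_seminorm M p f" by (simp add: Lp_seminorm_energy)
    have "Lp_energy M p (diag f) \<le> ennreal ((C * Lp_seminorm M p f) powr p)"
      using C(2)[OF f(1)] C(1) nn f p_pos by (simp add: Lp_energy_eq_seminorm powr_mult ennreal_mult)
    then have "Lp_seminorm M p (diag f) \<le> C * Lp_seminorm M p f"
      using C(1) nn f p_pos by (subst Lp_seminorm_le_iff) (auto simp: diag_Lp)
    then show "Lp_norm M p (diag_op u) \<le> C * Lp_norm M p u"
      using f by (simp add: diag_op_class Lp_norm_class diag_Lp)
  qed
qed

text \<open>Put g = e f and weight by the sign of j. Averaging \<psi> g inside \<open>a\<close>
  leaves \<open>\<phi> j\<close> times f; averaging \<psi> outside \<open>a\<close>, at a point of
  \<open>A j\<close>, leaves \<open>a g\<close>. The difference of the two is an average of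
  commutators, and the remaining factor \<open>\<phi> j\<close> has modulus at most 1.\<close>

lemma off_diagonal_energy:
  fixes f :: "'x \<Rightarrow> 'e"
  assumes e: "e \<in> borel_measurable M" "\<And>j x. j \<in> J \<Longrightarrow> x \<in> A j \<Longrightarrow> e x = \<phi> j x"
      "\<And>x. \<not> (\<exists>j\<in>J. x \<in> A j) \<Longrightarrow> e x = 0"
    and f: "f \<in> Lp_functions M p"
    and \<psi>: "\<And>B. \<psi> B \<in> borel_measurable M" "\<And>B x. cmod (\<psi> B x) \<le> 1"
      "\<And>B k x. k \<in> J \<Longrightarrow> x \<in> A k \<Longrightarrow> \<psi> B x = sign_of B k"
    and comm: "\<And>B. Lp_energy M p (\<lambda>x. rep (\<lambda>x. \<psi> B x *\<^sub>C e x *\<^sub>C f x) x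
        - \<psi> B x *\<^sub>C rep (\<lambda>x. e x *\<^sub>C f x) x) \<le> c"
  shows "Lp_energy M p (\<lambda>x. e x *\<^sub>C rep (\<lambda>x. e x *\<^sub>C f x) x - diag f x) \<le> c"
proof -
  have e_le_1: "cmod (e x) \<le> 1" for x
    using e(2)[of _ x] e(3)[of x] \<phi>_le_1 by (cases "\<exists>j\<in>J. x \<in> A j") auto
  define g where "g = (\<lambda>x. e x *\<^sub>C f x)"
  have g: "g \<in> Lp_functions M p"
    unfolding g_def using f e(1) e_le_1 p_pos by (rule_tac Lp_functions_mult[where B = 1]) auto
  have \<psi>_Lp: "(\<lambda>x. \<psi> B x *\<^sub>C h x) \<in> Lp_functions M p" if "h \<in> Lp_functions M p" for B and h :: "'x \<Rightarrow> 'e"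
    using that \<psi>(1,2) p_pos by (rule_tac Lp_functions_mult[where B = 1]) auto
  define cm where "cm B x = rep (\<lambda>x. \<psi> B x *\<^sub>C g x) x - \<psi> B x *\<^sub>C rep g x" for B x
  have cm_Lp: "cm B \<in> Lp_functions M p" for B
    unfolding cm_def using g p_pos by (intro Lp_functions_diff rep_Lp \<psi>_Lp)
  have cm_le: "Lp_energy M p (cm B) \<le> c" for B
    using comm[of B] unfolding cm_def g_def .
  define D where "D x = e x *\<^sub>C rep g x - diag f x" for x
  have eg: "(\<lambda>x. e x *\<^sub>C rep g x) \<in> Lp_functions M p"
    using rep_Lp[OF g] e(1) e_le_1 p_pos by (rule_tac Lp_functions_mult[where B = 1]) auto
  have D_Lp: "D \<in> Lp_functions M p"
    unfolding D_def using eg diag_Lp[OF f] p_pos by (intro Lp_functions_diff)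
  \<comment> \<open>The right-hand side does not depend on j because the signs have modulus 1. One
    function thus dominates on all blocks of \<open>F\<close> together, and the bound is not
    multiplied by the number of blocks.\<close>
  have average: "AE x in M. x \<in> A j \<longrightarrow>
      norm (D x) powr p \<le> (\<Sum>B\<in>Pow F. norm (cm B x) powr p) / real (card (Pow F))"
    if F: "finite F" "F \<subseteq> J" "j \<in> F" for F j
  proof -
    define N where "N = card (Pow F)"
    have N: "N > 0" using F by (auto simp: N_def card_gt_0_iff)
    have j: "j \<in> J" using F by blast
    \<comment> \<open>On a block k other than j the signs cancel, whether or not k lies in
      \<open>F\<close>. Off all blocks \<psi> is not prescribed, but there g vanishes.\<close>
    have split: "(\<lambda>x. \<Sum>B\<in>Pow F. (sign_of B j / of_nat N) *\<^sub>C \<psi> B x *\<^sub>C g x) = (\<lambda>x. \<phi> j x *\<^sub>C f x)"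
    proof
      fix x
      have "(\<Sum>B\<in>Pow F. (sign_of B j / of_nat N) * \<psi> B x) * e x = \<phi> j x"
      proof (cases "\<exists>k\<in>J. x \<in> A k")
        case True
        then obtain k where k: "k \<in> J" "x \<in> A k" by blast
        have "(\<Sum>B\<in>Pow F. (sign_of B j / of_nat N) * \<psi> B x)
            = (\<Sum>B\<in>Pow F. sign_of B j * sign_of B k) / of_nat N"
          using k by (simp add: \<psi>(3) sum_divide_distrib)
        also have "\<dots> = (if k = j then 1 else 0)"
          using N sum_sign_of[OF F(1,3), of k] by (simp add: N_def)
        finally have "(\<Sum>B\<in>Pow F. (sign_of B j / of_nat N) * \<psi> B x) = (if k = j then 1 else 0)" .
        moreover have "\<phi> j x = 0" if "k \<noteq> j"
          using k j that disjoint_family_onD[OF disjoint, of j k] by (intro \<phi>_zero) auto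
        ultimately show ?thesis using k e(2)[of k x] by auto
      next
        case False
        then have "e x = 0" "\<phi> j x = 0" using e(3) \<phi>_zero j by blast+
        then show ?thesis by simp
      qed
      moreover have "(\<Sum>B\<in>Pow F. (sign_of B j / of_nat N) *\<^sub>C \<psi> B x *\<^sub>C g x)
          = (\<Sum>B\<in>Pow F. (sign_of B j / of_nat N) * \<psi> B x) *\<^sub>C g x"
        by (simp only: scaleC_scaleC scaleC.sum_left)
      ultimately show "(\<Sum>B\<in>Pow F. (sign_of B j / of_nat N) *\<^sub>C \<psi> B x *\<^sub>C g x) = \<phi> j x *\<^sub>C f x"
        by (simp add: g_def scaleC_scaleC)
    qed
    have "AE x in M. rep (\<lambda>x. \<phi> j x *\<^sub>C f x) x
        = (\<Sum>B\<in>Pow F. (sign_of B j / of_nat N) *\<^sub>C rep (\<lambda>x. \<psi> B x *\<^sub>C g x) x)"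
      unfolding split[symmetric] using F g by (intro rep_sum \<psi>_Lp) auto
    then show ?thesis
    proof eventually_elim
      case (elim x)
      show ?case
      proof
        assume x: "x \<in> A j"
        \<comment> \<open>At a point of \<open>A j\<close> the value of \<psi> is the sign of j
          itself, and the square of a sign is 1.\<close>
        have "(\<Sum>B\<in>Pow F. (sign_of B j / of_nat N) *\<^sub>C \<psi> B x *\<^sub>C rep g x)
            = (\<Sum>B\<in>Pow F. (1 / of_nat N) *\<^sub>C rep g x)"
          using j x by (simp add: \<psi>(3) scaleC_scaleC)
        also have "\<dots> = (\<Sum>B\<in>Pow F. 1 / of_nat N) *\<^sub>C rep g x"
          by (rule scaleC.sum_left[symmetric])
        also have "\<dots> = rep g x"
          using N by (simp add: N_def[symmetric] scaleC_one)
        finally have "rep g x - rep (\<lambda>x. \<phi> j x *\<^sub>C f x) x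
            = - (\<Sum>B\<in>Pow F. (sign_of B j / of_nat N) *\<^sub>C cm B x)"
          unfolding elim cm_def by (simp add: scaleC.diff_right sum_subtractf)
        also have "(\<Sum>B\<in>Pow F. (sign_of B j / of_nat N) *\<^sub>C cm B x)
            = (\<Sum>B\<in>Pow F. (1 / real N) *\<^sub>R (sign_of B j *\<^sub>C cm B x))"
          by (intro sum.cong refl)
            (simp add: scaleC_of_real[symmetric] scaleC_scaleC)
        also have "\<dots> = (1 / real N) *\<^sub>R (\<Sum>B\<in>Pow F. sign_of B j *\<^sub>C cm B x)"
          by (rule scaleR_sum_right[symmetric])
        finally have diff: "rep g x - rep (\<lambda>x. \<phi> j x *\<^sub>C f x) x
            = - ((1 / real N) *\<^sub>R (\<Sum>B\<in>Pow F. sign_of B j *\<^sub>C cm B x))" .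
        have "D x = \<phi> j x *\<^sub>C (rep g x - rep (\<lambda>x. \<phi> j x *\<^sub>C f x) x)"
          using j x by (simp add: D_def diag_in e(2) scaleC.diff_right)
        then have "norm (D x) \<le> norm (rep g x - rep (\<lambda>x. \<phi> j x *\<^sub>C f x) x)"
          using \<phi>_le_1[OF j] by (simp add: norm_scaleC mult_left_le_one_le)
        also have "\<dots> = norm ((1 / real N) *\<^sub>R (\<Sum>B\<in>Pow F. sign_of B j *\<^sub>C cm B x))"
          unfolding diff by (rule norm_minus_cancel)
        finally have "norm (D x) powr p
            \<le> norm ((1 / real N) *\<^sub>R (\<Sum>B\<in>Pow F. sign_of B j *\<^sub>C cm B x)) powr p"
          using p_pos by (intro powr_mono2) auto
        also have "\<dots> \<le> (\<Sum>B\<in>Pow F. norm (sign_of B j *\<^sub>C cm B x) powr p) / real (card (Pow F))"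
          unfolding N_def using F p_ge_1 by (intro powr_norm_average_le) auto
        finally show "norm (D x) powr p
            \<le> (\<Sum>B\<in>Pow F. norm (cm B x) powr p) / real (card (Pow F))"
          by (simp add: norm_scaleC)
      qed
    qed
  qed
  have "Lp_energy M p D \<le> c"
  proof (rule energy_le_blocks)
    show "strongly_measurable M D" using D_Lp by (simp add: Lp_functions_iff)
    show "D x = 0" if "\<not> (\<exists>j\<in>J. x \<in> A j)" for x
      using e(3)[OF that] diag_out[OF that, of f] by (simp add: D_def scaleC.zero_left)
    fix F assume F: "finite F" "F \<subseteq> J"
    let ?W = "completion M"
    define N where "N = card (Pow F)"
    have N: "N > 0" using F by (auto simp: N_def card_gt_0_iff)
    have "AE x in M. \<forall>j\<in>F. x \<in> A j \<longrightarrow>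
        norm (D x) powr p \<le> (\<Sum>B\<in>Pow F. norm (cm B x) powr p) / real N"
      unfolding N_def using F(1) average[OF F] by (rule AE_finite_allI)
    then have "AE x in ?W. ennreal (norm (D x) powr p) * indicator (\<Union>j\<in>F. A j) x
        \<le> ennreal (1 / real N) * (\<Sum>B\<in>Pow F. ennreal (norm (cm B x) powr p))"
      unfolding AE_completion_iff
    proof eventually_elim
      case (elim x)
      show ?case
      proof (cases "\<exists>j\<in>F. x \<in> A j")
        case True
        with elim have "norm (D x) powr p \<le> 1 / real N * (\<Sum>B\<in>Pow F. norm (cm B x) powr p)"
          by auto
        then have "ennreal (norm (D x) powr p)
            \<le> ennreal (1 / real N) * ennreal (\<Sum>B\<in>Pow F. norm (cm B x) powr p)"
          by (simp add: ennreal_mult[symmetric] sum_nonneg ennreal_leI)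
        then show ?thesis using True by (simp add: sum_ennreal)
      qed (simp add: indicator_def)
    qed
    then have "(\<integral>\<^sup>+x. ennreal (norm (D x) powr p) * indicator (\<Union>j\<in>F. A j) x \<partial>?W)
        \<le> (\<integral>\<^sup>+x. ennreal (1 / real N) * (\<Sum>B\<in>Pow F. ennreal (norm (cm B x) powr p)) \<partial>?W)"
      by (rule nn_integral_mono_AE)
    also have "\<dots> = ennreal (1 / real N) * (\<integral>\<^sup>+x. (\<Sum>B\<in>Pow F. ennreal (norm (cm B x) powr p)) \<partial>?W)"
      using cm_Lp by (intro nn_integral_cmult borel_measurable_sum borel_measurable_energy)
        (simp add: Lp_functions_iff)
    also have "(\<integral>\<^sup>+x. (\<Sum>B\<in>Pow F. ennreal (norm (cm B x) powr p)) \<partial>?W) = (\<Sum>B\<in>Pow F. Lp_energy M p (cm B))"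
      unfolding Lp_energy_completion
      using cm_Lp by (intro nn_integral_sum borel_measurable_energy) (simp add: Lp_functions_iff)
    \<comment> \<open>The number of sign patterns cancels against the weight, which makes the bound
      uniform in \<open>F\<close>.\<close>
    also have "\<dots> \<le> of_nat N * c"
      unfolding N_def using cm_le by (intro sum_bounded_above)
    also have "ennreal (1 / real N) * (of_nat N * c) = c"
    proof -
      have "ennreal (1 / real N) * of_nat N = 1"
        using N by (simp add: ennreal_of_nat_eq_real_of_nat ennreal_mult[symmetric])
      then show ?thesis by (simp add: mult.assoc[symmetric])
    qed
    finally show "(\<integral>\<^sup>+x. ennreal (norm (D x) powr p) * indicator (\<Union>j\<in>F. A j) x \<partial>?W) \<le> c"
      by (simp add: mult_left_mono)
  qed
  then show ?thesis unfolding D_def[abs_def] g_def .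
qed

text \<open>On the blocks of \<open>F\<close> the partial sum equals \<open>diag f\<close>, and
  elsewhere it is 0. The error is therefore the tail of \<open>diag f\<close>, which is small as
  soon as \<open>F\<close> contains a suitable finite set.\<close>

lemma diag_strong_sum:
  fixes f :: "'x \<Rightarrow> 'e"
  assumes f: "f \<in> Lp_functions M p"
  shows "((\<lambda>F. Lp_seminorm M p (\<lambda>x. (\<Sum>j\<in>F. corner f j x) - diag f x)) \<longlongrightarrow> 0)
    (finite_subsets_at_top J)"
proof (rule tendstoI)
  fix r :: real assume r: "0 < r"
  let ?W = "completion M"
  let ?h = "\<lambda>x. ennreal (norm (diag f x) powr p)"
  have h: "?h \<in> borel_measurable ?W"
    using strongly_measurable_diag[OF f] by (rule borel_measurable_energy)
  have fin: "(\<integral>\<^sup>+x. ?h x \<partial>?W) < \<infinity>"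
    using diag_Lp[OF f] by (simp add: Lp_functions_iff Lp_energy_completion)
  \<comment> \<open>Half of r, since the comparison of energies yields only \<le> for the
    seminorm.\<close>
  have \<delta>: "0 < ennreal ((r / 2) powr p)" using r by simp
  obtain G where G: "finite G" "G \<subseteq> J"
      "(\<integral>\<^sup>+x. ?h x * indicator (\<Union>j\<in>J - G. A j) x \<partial>?W) < ennreal ((r / 2) powr p)"
    using nn_integral_UN_tail[OF h fin countable_blocks _ disjoint \<delta>] sets_A by auto
  show "\<forall>\<^sub>F F in finite_subsets_at_top J.
      dist (Lp_seminorm M p (\<lambda>x. (\<Sum>j\<in>F. corner f j x) - diag f x)) 0 < r"
    unfolding eventually_finite_subsets_at_top
  proof (intro exI[of _ G] conjI allI impI)
    fix F assume F: "finite F \<and> G \<subseteq> F \<and> F \<subseteq> J"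
    let ?d = "\<lambda>x. (\<Sum>j\<in>F. corner f j x) - diag f x"
    have d_Lp: "?d \<in> Lp_functions M p"
      using F f p_pos by (intro Lp_functions_diff Lp_functions_sum corner_Lp diag_Lp) auto
    have "Lp_energy M p ?d \<le> (\<integral>\<^sup>+x. ?h x * indicator (\<Union>j\<in>J - G. A j) x \<partial>?W)"
      unfolding Lp_energy_completion
    proof (rule nn_integral_mono)
      fix x
      have zero: "corner f j x = 0" if "j \<in> F" "x \<notin> A j" for j
        using that F \<phi>_zero[of j x] by (auto simp: scaleC.zero_left)
      show "ennreal (norm (?d x) powr p) \<le> ?h x * indicator (\<Union>j\<in>J - G. A j) x"
      proof (cases "\<exists>j\<in>F. x \<in> A j")
        case True
        then obtain j where j: "j \<in> F" "x \<in> A j" by blast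
        have "corner f k x = 0" if "k \<in> F - {j}" for k
          using that j F disjoint_family_onD[OF disjoint, of j k] by (intro zero) auto
        then have "(\<Sum>k\<in>F. corner f k x) = corner f j x"
          using F j by (simp add: sum.remove)
        then have "?d x = 0" using j F by (auto simp: diag_in)
        then show ?thesis by simp
      next
        case False
        then have s: "(\<Sum>k\<in>F. corner f k x) = 0" using zero by (intro sum.neutral) blast
        show ?thesis
        proof (cases "\<exists>j\<in>J. x \<in> A j")
          case True
          then have "x \<in> (\<Union>j\<in>J - G. A j)" using False F by blast
          then show ?thesis using s by simp
        next
          case False
          then show ?thesis using s diag_out[OF False, of f] by simp
        qed
      qed
    qed
    also note G(3)
    finally have "Lp_seminorm M p ?d \<le> r / 2"
      using r d_Lp p_pos by (subst Lp_seminorm_le_iff) auto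
    then show "dist (Lp_seminorm M p ?d) 0 < r"
      using r by (simp add: Lp_seminorm_energy)
  qed (use G in auto)
qed

end

text \<open>The class of g is admissible in the supremum defining the operator norm; the bound is
  then read off on representatives.\<close>

lemma (in Lp_operator) commutator_energy:
  fixes g :: "'x \<Rightarrow> 'e"
  assumes \<psi>: "\<psi> \<in> borel_measurable M" "\<And>x. cmod (\<psi> x) \<le> 1"
    and comm: "Lp_opnorm M p (Lp_commutator M p a \<psi>) < ennreal \<epsilon>" and \<epsilon>: "0 < \<epsilon>"
    and g: "g \<in> Lp_functions M p" "Lp_seminorm M p g \<le> 1"
  shows "Lp_energy M p (\<lambda>x. rep (\<lambda>x. \<psi> x *\<^sub>C g x) x - \<psi> x *\<^sub>C rep g x) \<le> ennreal (\<epsilon> powr p)"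
proof -
  have \<psi>_Lp: "(\<lambda>x. \<psi> x *\<^sub>C h x) \<in> Lp_functions M p" if "h \<in> Lp_functions M p" for h :: "'x \<Rightarrow> 'e"
    using that \<psi> p_pos by (rule_tac Lp_functions_mult[where B = 1]) auto
  have \<psi>_class: "Lp_mult M p \<psi> (Lp_class M p h) = Lp_class M p (\<lambda>x. \<psi> x *\<^sub>C h x)"
    if "h \<in> Lp_functions M p" for h :: "'x \<Rightarrow> 'e"
    using that \<psi> p_pos by (rule_tac Lp_mult_class[where B = 1]) auto
  let ?d = "\<lambda>x. rep (\<lambda>x. \<psi> x *\<^sub>C g x) x - \<psi> x *\<^sub>C rep g x"
  have d: "?d \<in> Lp_functions M p"
    using g p_pos by (intro Lp_functions_diff rep_Lp \<psi>_Lp)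
  have "Lp_commutator M p a \<psi> (Lp_class M p g) = Lp_class M p ?d"
    using g p_pos by (simp add: Lp_commutator_def \<psi>_class a_class rep_Lp \<psi>_Lp Lp_diff_class)
  moreover have "ennreal (Lp_norm M p (Lp_commutator M p a \<psi> (Lp_class M p g)))
      \<le> Lp_opnorm M p (Lp_commutator M p a \<psi>)"
    unfolding Lp_opnorm_def using g by (intro SUP_upper) (simp add: Lp_class_in Lp_norm_class)
  ultimately have "ennreal (Lp_seminorm M p ?d) < ennreal \<epsilon>"
    using comm d by (simp add: Lp_norm_class)
  then have "Lp_seminorm M p ?d \<le> \<epsilon>"
    using \<epsilon> by (simp add: ennreal_less_iff Lp_seminorm_energy)
  then show ?thesis using d \<epsilon> p_pos by (simp add: Lp_seminorm_le_iff)
qed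

subsection \<open>Separated families in metric spaces\<close>

text \<open>The triangle inequality along a, x, y, b, with infima taken over b and then over a.
  Having two base points x and y allows comparison across the gap between the sets.\<close>

lemma le_infdist_add:
  assumes "P \<noteq> {}" "Q \<noteq> {}" "\<And>a b. a \<in> P \<Longrightarrow> b \<in> Q \<Longrightarrow> r \<le> dist a b"
  shows "r \<le> infdist x P + dist x y + infdist y Q"
proof -
  have "r - dist x y - infdist x P \<le> infdist y Q"
    unfolding infdist_notempty[OF assms(2)]
  proof (rule cINF_greatest[OF assms(2)])
    fix b assume b: "b \<in> Q"
    have "r - dist x y - dist y b \<le> infdist x P"
      unfolding infdist_notempty[OF assms(1)]
    proof (rule cINF_greatest[OF assms(1)])
      fix a assume "a \<in> P"
      then have "r \<le> dist a b" using b assms(3) by blast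
      also have "\<dots> \<le> dist a x + dist x y + dist y b"
        using dist_triangle[of a b x] dist_triangle[of x b y] by linarith
      finally show "r - dist x y - dist y b \<le> dist x a" by (simp add: dist_commute)
    qed
    then show "r - dist x y - infdist x P \<le> dist y b" by linarith
  qed
  then show ?thesis by linarith
qed

text \<open>The witness is the difference of the tents 1 - L dist around \<open>P\<close> and
  \<open>Q\<close>, cut off at 0. A difference of two L-Lipschitz functions is in general only
  2L-Lipschitz; the critical case is x near \<open>P\<close> and y near \<open>Q\<close>, and there
  the gap 2/L gives \<open>u P x + u Q y \<le> L * dist x y\<close>.\<close>

lemma lipschitz_separation:
  fixes P Q :: "'x::metric_space set"
  assumes L: "0 < L" and sep: "\<And>a b. a \<in> P \<Longrightarrow> b \<in> Q \<Longrightarrow> 2 / L \<le> dist a b"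
  obtains \<psi> :: "'x \<Rightarrow>\<^sub>C complex" where "norm \<psi> \<le> 1" "L-lipschitz_on UNIV (apply_bcontfun \<psi>)"
    "\<And>x. x \<in> P \<Longrightarrow> apply_bcontfun \<psi> x = 1" "\<And>x. x \<in> Q \<Longrightarrow> apply_bcontfun \<psi> x = -1"
proof -
  \<comment> \<open>\<open>infdist\<close> to the empty set is 0, so the formula would give 1. The
    value -1 is cut off to 0 in \<open>w\<close>, and it offsets the other tent, which is at most
    1.\<close>
  define u where "u P x = (if P = {} then -1 else 1 - L * infdist x P)" for P and x :: 'x
  define w where "w x = max (u P x) 0 - max (u Q x) 0" for x
  have u_le_1: "u S x \<le> 1" for S x
    using L by (simp add: u_def infdist_nonneg)
  have u_lip: "u S x \<le> u S y + L * dist x y" for S x y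
  proof (cases "S = {}")
    case False
    have "L * infdist y S \<le> L * (infdist x S + dist y x)"
      using L infdist_triangle[of y S x] by (intro mult_left_mono) auto
    then show ?thesis using False by (simp add: u_def algebra_simps dist_commute)
  qed (use L in \<open>simp add: u_def\<close>)
  have u_sep: "u P x + u Q y \<le> L * dist x y" for x y
  proof (cases "P = {} \<or> Q = {}")
    case True
    have "u P x + u Q y \<le> 0"
    proof (cases "P = {}")
      case True
      then have "u P x = -1" by (simp add: u_def)
      then show ?thesis using u_le_1[of Q y] by linarith
    next
      case False
      then have "u Q y = -1" using True by (simp add: u_def)
      then show ?thesis using u_le_1[of P x] by linarith
    qed
    also have "0 \<le> L * dist x y" using L by simp
    finally show ?thesis .
  next
    case False
    have "L * (2 / L) \<le> L * (infdist x P + dist x y + infdist y Q)"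
      using False L sep by (intro mult_left_mono le_infdist_add) auto
    then show ?thesis using False L by (simp add: u_def algebra_simps)
  qed
  have w_lip1: "w x - w y \<le> L * dist x y" for x y
  proof -
    have "0 \<le> L * dist x y" using L by simp
    then show ?thesis
      using u_lip[of P x y] u_lip[of Q y x] u_sep[of x y]
      unfolding w_def dist_commute[of y x] by linarith
  qed
  have lip: "L-lipschitz_on UNIV (\<lambda>x. complex_of_real (w x))"
  proof (rule lipschitz_onI)
    fix x y
    have "\<bar>w x - w y\<bar> \<le> L * dist x y"
      using w_lip1[of x y] w_lip1[of y x] by (simp add: dist_commute abs_le_iff)
    then show "dist (complex_of_real (w x)) (complex_of_real (w y)) \<le> L * dist x y"
      by (simp add: dist_norm flip: of_real_diff)
  qed (use L in simp)
  have w_le_1: "\<bar>w x\<bar> \<le> 1" for x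
    using u_le_1[of P x] u_le_1[of Q x] by (auto simp: w_def)
  have bc: "(\<lambda>x. complex_of_real (w x)) \<in> bcontfun"
    using w_le_1 lipschitz_on_continuous_on[OF lip] by (intro bcontfun_normI[where b = 1]) auto
  define \<psi> where "\<psi> = Bcontfun (\<lambda>x. complex_of_real (w x))"
  have \<psi>: "apply_bcontfun \<psi> x = complex_of_real (w x)" for x
    unfolding \<psi>_def by (simp add: Bcontfun_inverse[OF bc])
  have one: "u S x = 1" if "x \<in> S" for S x
    using that by (auto simp: u_def)
  have disj: "u P x + u Q x \<le> 0" for x using u_sep[of x x] by simp
  show thesis
  proof
    show "norm \<psi> \<le> 1" using w_le_1 by (intro norm_bound) (simp add: \<psi>)
    show "L-lipschitz_on UNIV (apply_bcontfun \<psi>)" using lip by (simp add: \<psi> cong: lipschitz_on_cong)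
    show "apply_bcontfun \<psi> x = 1" if "x \<in> P" for x
      using one[OF that] disj[of x] by (simp add: \<psi> w_def)
    show "apply_bcontfun \<psi> x = -1" if "x \<in> Q" for x
      using one[OF that] disj[of x] by (simp add: \<psi> w_def)
  qed
qed

text \<open>A ball of radius r/2 meets at most one member. By properness each closed ball of integer
  radius is covered by finitely many of these, so it meets finitely many members.\<close>

lemma countable_separated_family:
  fixes A :: "'j \<Rightarrow> 'x::metric_space set"
  assumes proper: "proper_space TYPE('x)" and r: "0 < r"
    and sep: "\<And>j k x y. j \<in> J \<Longrightarrow> k \<in> J \<Longrightarrow> j \<noteq> k \<Longrightarrow> x \<in> A j \<Longrightarrow> y \<in> A k \<Longrightarrow> r \<le> dist x y"
  shows "countable {j\<in>J. A j \<noteq> {}}"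
proof -
  fix c :: 'x
  have fin: "finite {j\<in>J. A j \<inter> cball c (real n) \<noteq> {}}" for n
  proof -
    have "compact (closure (cball c (real n)))"
      using proper by (auto simp: proper_space_def)
    then have K: "compact (cball c (real n))" by simp
    have "x \<in> ball x (r / 2)" for x :: 'x using r by simp
    then have cover: "cball c (real n) \<subseteq> (\<Union>t. ball t (r / 2))" by blast
    obtain T where T: "finite T" "cball c (real n) \<subseteq> (\<Union>t\<in>T. ball t (r / 2))"
      using compactE_image[OF K open_ball cover] by metis
    have "finite {j\<in>J. A j \<inter> ball t (r / 2) \<noteq> {}}" for t
    proof -
      have "j = k" if "j \<in> J" "k \<in> J" "x \<in> A j \<inter> ball t (r / 2)" "y \<in> A k \<inter> ball t (r / 2)" for j k x y
      proof (rule ccontr)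
        assume "j \<noteq> k"
        then have "r \<le> dist x y" using that sep by blast
        also have "\<dots> < r" using that by (auto intro: dist_triangle_half_r[of t])
        finally show False by simp
      qed
      then have "\<exists>i. {j\<in>J. A j \<inter> ball t (r / 2) \<noteq> {}} \<subseteq> {i}" by blast
      then show ?thesis using finite_subset by blast
    qed
    then have "finite (\<Union>t\<in>T. {j\<in>J. A j \<inter> ball t (r / 2) \<noteq> {}})" using T(1) by blast
    then show ?thesis by (rule rev_finite_subset) (use T(2) in blast)
  qed
  have "{j\<in>J. A j \<noteq> {}} \<subseteq> (\<Union>n. {j\<in>J. A j \<inter> cball c (real n) \<noteq> {}})"
  proof
    fix j assume "j \<in> {j\<in>J. A j \<noteq> {}}"
    then obtain x where x: "j \<in> J" "x \<in> A j" by blast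
    then have "x \<in> A j \<inter> cball c (real (nat \<lceil>dist c x\<rceil>))" by simp
    with x show "j \<in> (\<Union>n. {j\<in>J. A j \<inter> cball c (real n) \<noteq> {}})" by blast
  qed
  then show ?thesis
    by (rule countable_subset) (intro countable_UN countableI_type countable_finite fin)
qed

section \<open>The given family as separated blocks, and the final estimate\<close>

theorem proposition4p1:
  fixes M :: "'x::metric_space measure"
    and p L \<epsilon> :: real
    and a :: "('x \<Rightarrow> 'e::complex_banach) set \<Rightarrow> ('x \<Rightarrow> 'e) set"
    and es :: "'j \<Rightarrow> ('x \<Rightarrow>\<^sub>C complex)"
    and J :: "'j set"
    and e :: "'x \<Rightarrow> complex"
  assumes "proper_space TYPE('x)"
    and "radon_measure M"
    and "full_support M"
    and "1 \<le> p"
    and "0 < L"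
    and "0 < \<epsilon>"
    and "a \<in> Commut M p L \<epsilon>"
    and "equicontinuous_family (\<lambda>j. apply_bcontfun (es j)) J"
    and "\<And>j. j \<in> J \<Longrightarrow> positive_contraction (es j)"
    and "R_disjoint (2 / L) (\<lambda>j. closed_support (apply_bcontfun (es j))) J"
    and "e = (\<lambda>x. \<Sum>\<^sub>\<infinity>j\<in>J. apply_bcontfun (es j) x)"
  shows "e \<in> bcontfun \<and>
    (\<exists>S \<in> Lp_bounded_operators M p.
      has_strong_sum M p
        (\<lambda>j u. Lp_mult M p (apply_bcontfun (es j)) (a (Lp_mult M p (apply_bcontfun (es j)) u))) J S \<and>
      Lp_opnorm M p (\<lambda>u. Lp_diff M p (Lp_mult M p e (a (Lp_mult M p e u))) (S u)) \<le> ennreal \<epsilon>)"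
proof -
  define \<phi> where "\<phi> j = apply_bcontfun (es j)" for j
  \<comment> \<open>The open sets of nonvanishing serve as blocks: they are measurable, and they
    inherit the separation of the closed supports containing them.\<close>
  define A where "A j = {x. \<phi> j x \<noteq> 0}" for j
  have sets_M: "sets M = sets borel" using assms(2) by (simp add: radon_measure_def)
  have borel: "h \<in> borel_measurable M" if "continuous_on UNIV h" for h :: "'x \<Rightarrow> complex"
    using borel_measurable_continuous_onI[OF that] sets_M by (simp cong: measurable_cong_sets)
  have \<phi>_cont: "continuous_on UNIV (\<phi> j)" for j
    unfolding \<phi>_def by (rule continuous_on_apply_bcontfun)
  have \<phi>_le_1: "cmod (\<phi> j x) \<le> 1" if "j \<in> J" for j x
    using norm_bounded[of "es j" x] assms(9)[OF that] by (simp add: positive_contraction_def \<phi>_def)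
  have sep: "2 / L < dist x y" if "j \<in> J" "k \<in> J" "j \<noteq> k" "x \<in> A j" "y \<in> A k" for j k x y
  proof -
    have "x \<in> closed_support (\<phi> j)" "y \<in> closed_support (\<phi> k)"
      using that by (auto simp: closed_support_def A_def intro!: closure_subset[THEN subsetD])
    moreover from this have "2 / L < setdist (closed_support (\<phi> j)) (closed_support (\<phi> k))"
      using assms(10) that unfolding R_disjoint_def \<phi>_def by blast
    ultimately show ?thesis using setdist_le_dist by (meson less_le_trans)
  qed
  have r: "0 < 2 / L" using assms(5) by simp
  have disj: "disjoint_family_on A J"
    unfolding disjoint_family_on_def using sep r by (fastforce simp: disjoint_iff)
  interpret Lp_blocks M p a A J \<phi>
  proof
    show "1 \<le> p" by fact
    show "a \<in> Lp_bounded_operators M p" using assms(7) unfolding Commut_def by blast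
    show "disjoint_family_on A J" by fact
    show "countable {j\<in>J. A j \<noteq> {}}"
      by (rule countable_separated_family[OF assms(1) r]) (rule less_imp_le[OF sep])
    show "A j \<in> sets M" for j
      unfolding A_def sets_M using \<phi>_cont by (intro borel_open open_Collect_neq) auto
    show "\<phi> j \<in> borel_measurable M" for j by (rule borel[OF \<phi>_cont])
    show "cmod (\<phi> j x) \<le> 1" if "j \<in> J" for j x using that by (rule \<phi>_le_1)
    show "\<phi> j x = 0" if "x \<notin> A j" for j x using that by (simp add: A_def)
  qed
  \<comment> \<open>At most one term is nonzero, so \<open>infsum\<close> is a finite sum here and
    its default value for divergent sums does not intervene.\<close>
  have e_in: "e x = \<phi> j x" if "j \<in> J" "x \<in> A j" for j x
  proof -
    have "infsum (\<lambda>i. \<phi> i x) J = infsum (\<lambda>i. \<phi> i x) {j}"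
      using that disj by (intro infsum_cong_neutral) (auto simp: disjoint_family_on_def A_def)
    then show ?thesis by (simp add: assms(11) \<phi>_def)
  qed
  have e_out: "e x = 0" if "\<not> (\<exists>j\<in>J. x \<in> A j)" for x
  proof -
    have "infsum (\<lambda>i. \<phi> i x) J = infsum (\<lambda>i. \<phi> i x) {}"
      using that by (intro infsum_cong_neutral) (auto simp: A_def)
    then show ?thesis by (simp add: assms(11) \<phi>_def)
  qed
  have e_le_1: "cmod (e x) \<le> 1" for x
    using e_in[of _ x] e_out[of x] \<phi>_le_1 by (cases "\<exists>j\<in>J. x \<in> A j") auto
  \<comment> \<open>Two points of a ball of radius 1/L are less than 2/L apart, so the ball meets at
    most one block, and on it \<open>e\<close> coincides with a single \<open>\<phi> j\<close> or
    with 0.\<close>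
  have e_cont: "continuous_on UNIV e"
    unfolding continuous_on_eq_continuous_at[OF open_UNIV]
  proof
    fix x
    have "\<exists>h. continuous_on UNIV h \<and> (\<forall>y\<in>ball x (1 / L). h y = e y)"
    proof (cases "\<exists>j\<in>J. A j \<inter> ball x (1 / L) \<noteq> {}")
      case True
      then obtain j z where j: "j \<in> J" "z \<in> A j" "dist x z < 1 / L" by auto
      have "\<phi> j y = e y" if y: "y \<in> ball x (1 / L)" for y
      proof (cases "y \<in> A j")
        case False
        have "y \<notin> A k" if "k \<in> J" for k
        proof
          assume k: "y \<in> A k"
          with False have "2 / L < dist z y" using j that by (intro sep[of j k]) auto
          also have "\<dots> \<le> dist x z + dist x y" by (metis dist_commute dist_triangle)
          also have "\<dots> < 1 / L + 1 / L" using j y by (intro add_strict_mono) auto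
          finally show False by simp
        qed
        then show ?thesis using e_out[of y] False by (auto simp: A_def)
      qed (use e_in j in simp)
      then show ?thesis using \<phi>_cont by blast
    next
      case False
      then have "e y = 0" if "y \<in> ball x (1 / L)" for y
        using that by (intro e_out) blast
      then show ?thesis by (intro exI[of _ "\<lambda>_. 0"]) auto
    qed
    then obtain h where h: "continuous_on UNIV h" "\<And>y. y \<in> ball x (1 / L) \<Longrightarrow> h y = e y" by blast
    have "eventually (\<lambda>y. h y = e y) (nhds x)"
      unfolding eventually_nhds using h(2) assms(5) by (intro exI[of _ "ball x (1 / L)"]) auto
    moreover have "isCont h x" using h(1) by (simp add: continuous_on_eq_continuous_at)
    ultimately show "isCont e x" using isCont_cong by blast
  qed
  have e_bc: "e \<in> bcontfun"
    using e_le_1 e_cont by (intro bcontfun_normI) auto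
  have "\<exists>\<psi> :: 'x \<Rightarrow>\<^sub>C complex. norm \<psi> \<le> 1 \<and> L-lipschitz_on UNIV (apply_bcontfun \<psi>) \<and>
      (\<forall>k x. k \<in> J \<longrightarrow> x \<in> A k \<longrightarrow> apply_bcontfun \<psi> x = sign_of B k)" for B
  proof -
    \<comment> \<open>\<open>B\<close> is an arbitrary set of indices, hence the intersection with
      \<open>J\<close> and the complement inside \<open>J\<close>.\<close>
    have *: "2 / L \<le> dist x y" if "x \<in> (\<Union>k\<in>J \<inter> B. A k)" "y \<in> (\<Union>k\<in>J - B. A k)" for x y
      using that sep by (force intro: less_imp_le)
    show ?thesis
    proof (rule lipschitz_separation[OF assms(5) *])
      fix \<psi> :: "'x \<Rightarrow>\<^sub>C complex"
      assume "norm \<psi> \<le> 1" "L-lipschitz_on UNIV (apply_bcontfun \<psi>)"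
        and "\<And>x. x \<in> (\<Union>k\<in>J \<inter> B. A k) \<Longrightarrow> apply_bcontfun \<psi> x = 1"
        and "\<And>x. x \<in> (\<Union>k\<in>J - B. A k) \<Longrightarrow> apply_bcontfun \<psi> x = -1"
      then show ?thesis by (intro exI[of _ \<psi>]) (auto simp: sign_of_def)
    qed
  qed
  then obtain \<psi> :: "'j set \<Rightarrow> 'x \<Rightarrow>\<^sub>C complex" where \<psi>: "\<And>B. norm (\<psi> B) \<le> 1"
    "\<And>B. L-lipschitz_on UNIV (apply_bcontfun (\<psi> B))"
    "\<And>B k x. k \<in> J \<Longrightarrow> x \<in> A k \<Longrightarrow> apply_bcontfun (\<psi> B) x = sign_of B k" by metis
  have \<psi>_borel: "apply_bcontfun (\<psi> B) \<in> borel_measurable M" for B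
    by (intro borel continuous_on_apply_bcontfun)
  have \<psi>_le_1: "cmod (apply_bcontfun (\<psi> B) x) \<le> 1" for B x
    using norm_bounded[of "\<psi> B" x] \<psi>(1)[of B] by linarith
  have \<psi>_comm: "Lp_opnorm M p (Lp_commutator M p a (apply_bcontfun (\<psi> B))) < ennreal \<epsilon>" for B
    using assms(7) \<psi>(1,2)[of B] by (auto simp: Commut_def)
  have e_Lp: "(\<lambda>x. e x *\<^sub>C f x) \<in> Lp_functions M p" if "f \<in> Lp_functions M p" for f :: "'x \<Rightarrow> 'e"
    using that borel[OF e_cont] e_le_1 p_pos by (rule_tac Lp_functions_mult[where B = 1]) auto
  have e_class: "Lp_mult M p e (Lp_class M p f) = Lp_class M p (\<lambda>x. e x *\<^sub>C f x)"
    if "f \<in> Lp_functions M p" for f :: "'x \<Rightarrow> 'e"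
    using that borel[OF e_cont] e_le_1 p_pos by (rule_tac Lp_mult_class[where B = 1]) auto
  have \<phi>_class: "Lp_mult M p (\<phi> j) (Lp_class M p f) = Lp_class M p (\<lambda>x. \<phi> j x *\<^sub>C f x)"
    if "f \<in> Lp_functions M p" "j \<in> J" for j and f :: "'x \<Rightarrow> 'e"
    using that borel[OF \<phi>_cont] \<phi>_le_1 p_pos by (rule_tac Lp_mult_class[where B = 1]) auto
  have strong: "has_strong_sum M p (\<lambda>j u. Lp_mult M p (\<phi> j) (a (Lp_mult M p (\<phi> j) u))) J diag_op"
    unfolding has_strong_sum_def
  proof
    fix u :: "('x \<Rightarrow> 'e) set" assume "u \<in> Lp M p"
    then obtain f where f: "f \<in> Lp_functions M p" "u = Lp_class M p f" by (elim Lp_cases)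
    have "Lp_norm M p (Lp_diff M p (Lp_sum M p F (\<lambda>j. Lp_mult M p (\<phi> j) (a (Lp_mult M p (\<phi> j) u)))) (diag_op u))
        = Lp_seminorm M p (\<lambda>x. (\<Sum>j\<in>F. corner f j x) - diag f x)" if F: "finite F" "F \<subseteq> J" for F
    proof -
      have "Lp_sum M p F (\<lambda>j. Lp_mult M p (\<phi> j) (a (Lp_mult M p (\<phi> j) u)))
          = Lp_sum M p F (\<lambda>j. Lp_class M p (corner f j))"
      proof -
        have "Lp_mult M p (\<phi> j) (a (Lp_mult M p (\<phi> j) u)) = Lp_class M p (corner f j)" if "j \<in> F" for j
          using that F f by (simp add: subset_iff \<phi>_class a_class rep_Lp \<phi>_Lp)
        \<comment> \<open>\<open>Lp_sum\<close> sees its family only through \<open>Pi F\<close>, so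
          agreement on \<open>F\<close> suffices.\<close>
        then have "Pi F (\<lambda>j. Lp_mult M p (\<phi> j) (a (Lp_mult M p (\<phi> j) u)))
            = Pi F (\<lambda>j. Lp_class M p (corner f j))"
          by (auto simp: Pi_iff)
        then show ?thesis by (simp only: Lp_sum_def)
      qed
      also have "\<dots> = Lp_class M p (\<lambda>x. \<Sum>j\<in>F. corner f j x)"
        using F f p_pos corner_Lp[OF f(1)] by (intro Lp_sum_class) auto
      finally show ?thesis
        using F f p_pos corner_Lp[OF f(1)]
        by (simp add: diag_op_class Lp_diff_class Lp_functions_sum diag_Lp Lp_norm_class
            Lp_functions_diff subset_iff)
    qed
    then have "\<forall>\<^sub>F F in finite_subsets_at_top J.
        Lp_seminorm M p (\<lambda>x. (\<Sum>j\<in>F. corner f j x) - diag f x)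
        = Lp_norm M p (Lp_diff M p (Lp_sum M p F (\<lambda>j. Lp_mult M p (\<phi> j) (a (Lp_mult M p (\<phi> j) u)))) (diag_op u))"
      by (intro eventually_finite_subsets_at_top_weakI) simp
    then show "((\<lambda>F. Lp_norm M p (Lp_diff M p (Lp_sum M p F
        (\<lambda>j. Lp_mult M p (\<phi> j) (a (Lp_mult M p (\<phi> j) u)))) (diag_op u))) \<longlongrightarrow> 0) (finite_subsets_at_top J)"
      using diag_strong_sum[OF f(1)] by (rule Lim_transform_eventually[rotated])
  qed
  have "Lp_opnorm M p (\<lambda>u. Lp_diff M p (Lp_mult M p e (a (Lp_mult M p e u))) (diag_op u)) \<le> ennreal \<epsilon>"
    unfolding Lp_opnorm_def
  proof (rule SUP_least)
    fix u :: "('x \<Rightarrow> 'e) set" assume "u \<in> {u \<in> Lp M p. Lp_norm M p u \<le> 1}"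
    then have u: "u \<in> Lp M p" "Lp_norm M p u \<le> 1" by auto
    obtain f where f: "f \<in> Lp_functions M p" "u = Lp_class M p f" using u(1) by (elim Lp_cases)
    let ?g = "\<lambda>x. e x *\<^sub>C f x"
    let ?D = "\<lambda>x. e x *\<^sub>C rep ?g x - diag f x"
    \<comment> \<open>The commutators are tested on e f rather than f, and multiplication by
      \<open>e\<close> keeps the unit ball.\<close>
    have "Lp_energy M p ?g \<le> Lp_energy M p f"
      using e_le_1 p_pos by (intro Lp_energy_mono_AE) (auto simp: norm_scaleC mult_left_le_one_le)
    also have "\<dots> \<le> ennreal (1 powr p)"
      using u f p_pos by (subst Lp_seminorm_le_iff[symmetric]) (auto simp: Lp_norm_class)
    finally have "Lp_seminorm M p ?g \<le> 1"
      using f p_pos by (subst Lp_seminorm_le_iff) (auto simp: e_Lp)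
    then have "Lp_energy M p (\<lambda>x. rep (\<lambda>x. apply_bcontfun (\<psi> B) x *\<^sub>C ?g x) x
        - apply_bcontfun (\<psi> B) x *\<^sub>C rep ?g x) \<le> ennreal (\<epsilon> powr p)" for B
      using \<psi>_borel \<psi>_le_1 \<psi>_comm assms(6) e_Lp[OF f(1)] by (intro commutator_energy)
    then have "Lp_energy M p ?D \<le> ennreal (\<epsilon> powr p)"
      using off_diagonal_energy[OF borel[OF e_cont] e_in e_out f(1),
          where \<psi> = "\<lambda>B. apply_bcontfun (\<psi> B)"] \<psi>_borel \<psi>_le_1 \<psi>(3) by blast
    moreover have D: "?D \<in> Lp_functions M p"
      using f p_pos by (intro Lp_functions_diff e_Lp rep_Lp diag_Lp)
    ultimately have "Lp_seminorm M p ?D \<le> \<epsilon>"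
      using assms(6) p_pos by (subst Lp_seminorm_le_iff) auto
    moreover have "Lp_diff M p (Lp_mult M p e (a (Lp_mult M p e u))) (diag_op u) = Lp_class M p ?D"
      using f p_pos by (simp add: e_class a_class e_Lp rep_Lp diag_op_class diag_Lp Lp_diff_class)
    ultimately show "ennreal (Lp_norm M p (Lp_diff M p (Lp_mult M p e (a (Lp_mult M p e u))) (diag_op u)))
        \<le> ennreal \<epsilon>"
      using D by (simp add: Lp_norm_class ennreal_leI)
  qed
  then show ?thesis
    using e_bc diag_op_bounded strong unfolding \<phi>_def by blast
qed

end
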